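(* Let $(\Omega,\mathcal{F},\mathbb{P},\sigma)$ be an ergodic probability measure-preserving dynamical system and let $F\in\widetilde{\mathcal{E}}(\Omega)$ be an integrable random lift of the generator of a random circle endomorphism over $(\Omega,\mathcal{F},\mathbb{P},\sigma)$, with lower and upper maps $F_L,F_U$. For any $a,b\in[\rho(F_L),\rho(F_U)]$ with $a\le b$, there exists a full-measure set $\Omega_{a,b}\subset\Omega$ such that for every $\omega\in\Omega_{a,b}$ there exists $x_{a,b}(\omega)\in\mathbb{R}$ satisfying $$\liminf_{n\to\infty}\frac{F^{(n)}_\omega(x_{a,b}(\omega))-x_{a,b}(\omega)}{n}=a\quad\text{and}\quad\limsup_{n\to\infty}\frac{F^{(n)}_\omega(x_{a,b}(\omega))-x_{a,b}(\omega)}{n}=b.$$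
   Context: $\mathbb{S}^1=\mathbb{R}/\mathbb{Z}$, $\pi:\mathbb{R}\to\mathbb{S}^1$ is the projection. $\mathrm{End}_1(\mathbb{S}^1)$ is the set of continuous degree-one circle maps; $\mathrm{End}_1(\mathbb{R})$ is the set of continuous $F:\mathbb{R}\to\mathbb{R}$ with $F(x+1)=F(x)+1$ for all $x$; $\mathrm{Mon}_1(\mathbb{R})$ is the set of non-decreasing elements of $\mathrm{End}_1(\mathbb{R})$. A random circle endomorphism over $(\Omega,\mathcal{F},\mathbb{P},\sigma)$ is given by a generator, i.e. a measurable map $f:\Omega\to\mathrm{End}_1(\mathbb{S}^1)$, $\omega\mapsto f_\omega$, through the cocycle $f^{(n)}_\omega=f_{\sigma^{n-1}\omega}\circ\cdots\circ f_\omega$. A random lift of $f$ is a measurable map $F:\Omega\to\mathrm{End}_1(\mathbb{R})$ with $\pi\circ F_\omega=f_\omega\circ\pi$ for every $\omega$; its cocycle is $F^{(n)}_\omega=F_{\sigma^{n-1}\omega}\circ\cdots\circ F_\omega$. $\widetilde{\mathcal{E}}(\Omega)$ is the set of measurable $F:\Omega\to\mathrm{End}_1(\mathbb{R})$ with $\int_\Omega\|F_\omega-\mathrm{Id}\|\,\mathrm{d}\mathbb{P}(\omega)<\infty$, where $\|\cdot\|$ is the sup norm; $\widetilde{\mathcal{M}}(\Omega)$ is the subset of those $F$ with values in $\mathrm{Mon}_1(\mathbb{R})$. Lower and upper maps: $F_{\omega,L}(x)=\inf_{y\ge x}F_\omega(y)$, $F_{\omega,U}(x)=\sup_{y\le x}F_\omega(y)$;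 both $F_L,F_U$ belong to $\widetilde{\mathcal{M}}(\Omega)$. For $G\in\widetilde{\mathcal{M}}(\Omega)$, by a known result (Li–Lu) there is an integrable function $\rho_G$, the random rotation number, such that for any $x\in\mathbb{R}$, $\lim_{n\to\infty}(G^{(n)}_\omega(x)-x)/n=\rho_G(\omega)$ for a.e. $\omega$; $\rho(G)=\int_\Omega\rho_G\,\mathrm{d}\mathbb{P}$ is its mean (for ergodic $\sigma$, $\rho_G=\rho(G)$ a.e.). *)

theory Defs
  imports "HOL-Probability.Probability"
begin

section \<open>The circle as the quotient of the reals by the integers\<close>

quotient_type circle = real / "\<lambda>x y :: real. x - y \<in> \<int>"
proof (rule equivpI)
  show "reflp (\<lambda>x y :: real. x - y \<in> \<int>)" by (simp add: reflp_def)
  show "symp (\<lambda>x y :: real. x - y \<in> \<int>)"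
    by (auto simp: symp_def dest: Ints_minus)
  show "transp (\<lambda>x y :: real. x - y \<in> \<int>)"
    unfolding transp_def using Ints_add by fastforce
qed

definition proj :: "real \<Rightarrow> circle" where
  "proj = abs_circle"

lemma proj_eq_iff: "proj x = proj y \<longleftrightarrow> x - y \<in> \<int>"
  unfolding proj_def by (rule circle.abs_eq_iff)

lemma proj_surj: "\<exists>x. p = proj x"
  unfolding proj_def by (metis Quotient_circle Quotient_abs_rep)

instantiation circle :: metric_space
begin

text \<open>The quotient metric: the distance of two cosets as subsets of the line.\<close>

definition dist_circle :: "circle \<Rightarrow> circle \<Rightarrow> real" where
  "dist_circle p q = setdist {x. proj x = p} {y. proj y = q}"

definition uniformity_circle :: "(circle \<times> circle) filter" where
  "uniformity_circle = (INF e\<in>{0<..}. principal {(p, q). dist p q < e})"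

definition open_circle :: "circle set \<Rightarrow> bool" where
  "open_circle U = (\<forall>p\<in>U. eventually (\<lambda>(p', q). p' = p \<longrightarrow> q \<in> U) uniformity)"

lemma dist_proj_le: "dist (proj x) (proj y) \<le> \<bar>x - y\<bar>"
  unfolding dist_circle_def
  using setdist_le_dist[of x "{z. proj z = proj x}" y "{z. proj z = proj y}"]
  by (simp add: dist_real_def)

lemma dist_proj: "dist (proj x) (proj y) = \<bar>x - y - of_int (round (x - y))\<bar>"
proof (rule antisym)
  have "proj (y + of_int (round (x - y))) = proj y"
    by (simp add: proj_eq_iff)
  then show "dist (proj x) (proj y) \<le> \<bar>x - y - of_int (round (x - y))\<bar>"
    using dist_proj_le[of x "y + of_int (round (x - y))"]
    by (simp add: algebra_simps)
next
  show "\<bar>x - y - of_int (round (x - y))\<bar> \<le> dist (proj x) (proj y)"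
    unfolding dist_circle_def
  proof (rule le_setdistI)
    fix u v assume "u \<in> {z. proj z = proj x}" "v \<in> {z. proj z = proj y}"
    then obtain k l where "u - x = of_int k" "v - y = of_int l"
      by (auto simp: proj_eq_iff elim!: Ints_cases)
    then have "dist u v = \<bar>(x - y) - of_int (l - k)\<bar>"
      by (simp add: dist_real_def algebra_simps)
    then show "\<bar>x - y - of_int (round (x - y))\<bar> \<le> dist u v"
      using round_diff_minimal[of "x - y" "l - k"] by simp
  qed auto
qed

lemma dist_proj_attained:
  obtains y' where "proj y' = proj y" "dist (proj x) (proj y) = \<bar>x - y'\<bar>"
proof
  show "proj (y + of_int (round (x - y))) = proj y"
    by (simp add: proj_eq_iff)
  show "dist (proj x) (proj y) = \<bar>x - (y + of_int (round (x - y)))\<bar>"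
    by (simp add: dist_proj algebra_simps)
qed

instance
proof
  fix p q r :: circle
  obtain x y where p: "p = proj x" and q: "q = proj y"
    using proj_surj by metis
  show "dist p q = 0 \<longleftrightarrow> p = q"
  proof
    assume "dist p q = 0"
    then have "x - y = of_int (round (x - y))"
      by (simp add: p q dist_proj)
    then show "p = q"
      unfolding p q proj_eq_iff by (metis Ints_of_int)
  next
    assume "p = q"
    then show "dist p q = 0"
      by (simp add: p q dist_proj)
  qed
  obtain z where r: "r = proj z"
    using proj_surj by metis
  obtain x' where x': "proj x' = p" "dist r p = \<bar>z - x'\<bar>"
    using dist_proj_attained[where x = z and y = x] unfolding p r by metis
  obtain y' where y': "proj y' = q" "dist r q = \<bar>z - y'\<bar>"
    using dist_proj_attained[where x = z and y = y] unfolding q r by metis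
  have "dist p r = dist r p" "dist q r = dist r q"
    by (simp_all add: dist_circle_def setdist_sym)
  moreover have "dist p q \<le> \<bar>x' - y'\<bar>"
    using dist_proj_le[of x' y'] x' y' by simp
  ultimately show "dist p q \<le> dist p r + dist q r"
    using x' y' by linarith
qed (simp_all add: uniformity_circle_def open_circle_def)

end

lemma open_circle_iff_quotient: "open U \<longleftrightarrow> open (proj -` U)"
proof
  assume U: "open U"
  show "open (proj -` U)"
    unfolding open_dist
  proof
    fix x assume "x \<in> proj -` U"
    then obtain e where "e > 0" "\<forall>q. dist q (proj x) < e \<longrightarrow> q \<in> U"
      using U unfolding open_dist by auto
    moreover have "dist (proj y) (proj x) < e" if "dist y x < e" for y
      using that dist_proj_le[of y x] by (simp add: dist_real_def)
    ultimately show "\<exists>e>0. \<forall>y. dist y x < e \<longrightarrow> y \<in> proj -` U"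
      by (metis vimageI)
  qed
next
  assume U: "open (proj -` U)"
  show "open U"
    unfolding open_dist
  proof
    fix p assume "p \<in> U"
    obtain x where p: "p = proj x" using proj_surj by metis
    with U \<open>p \<in> U\<close> obtain e where e: "e > 0" "\<forall>y. dist y x < e \<longrightarrow> y \<in> proj -` U"
      unfolding open_dist by auto
    have "q \<in> U" if "dist q p < e" for q
    proof -
      obtain y where q: "q = proj y" using proj_surj by metis
      obtain y' where "proj y' = proj y" "dist (proj x) (proj y) = \<bar>x - y'\<bar>"
        by (rule dist_proj_attained)
      then have "dist y' x < e"
        using that by (simp add: p q dist_real_def dist_commute abs_minus_commute)
      with e have "proj y' \<in> U" by blast
      then show ?thesis
        using \<open>proj y' = proj y\<close> q by simp
    qed
    with e show "\<exists>e>0. \<forall>q. dist q p < e \<longrightarrow> q \<in> U" by blast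
  qed
qed


section \<open>Degree-one maps\<close>

definition End1_real :: "(real \<Rightarrow> real) set" where
  "End1_real = {F. continuous_on UNIV F \<and> (\<forall>x. F (x + 1) = F x + 1)}"

definition has_degree :: "(circle \<Rightarrow> circle) \<Rightarrow> int \<Rightarrow> bool" where
  "has_degree f d \<longleftrightarrow>
     (\<exists>F. continuous_on UNIV F \<and> (\<forall>x. F (x + 1) = F x + of_int d) \<and> proj \<circ> F = f \<circ> proj)"

definition End1_circle :: "(circle \<Rightarrow> circle) set" where
  "End1_circle = {f. continuous_on UNIV f \<and> has_degree f 1}"

definition sup_dist :: "('a \<Rightarrow> 'b::metric_space) \<Rightarrow> ('a \<Rightarrow> 'b) \<Rightarrow> real" where
  "sup_dist f g = (SUP x. dist (f x) (g x))"

text \<open>The Borel sigma-algebra of a set \<open>A\<close> of maps for the topology of the uniform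
  distance. The supremum in \<^const>\<open>sup_dist\<close> is only meaningful when it is taken over a
  bounded set; the two lemmas below show that this is so for degree-one maps.\<close>

definition sup_borel :: "('a \<Rightarrow> 'b::metric_space) set \<Rightarrow> ('a \<Rightarrow> 'b) measure" where
  "sup_borel A =
     sigma A {U. U \<subseteq> A \<and> (\<forall>f\<in>U. \<exists>e>0. \<forall>g\<in>A. sup_dist f g < e \<longrightarrow> g \<in> U)}"

lemma End1_real_bdd:
  assumes "F \<in> End1_real" "G \<in> End1_real"
  shows "bdd_above (range (\<lambda>x. dist (F x) (G x)))"
proof -
  have shift: "H (x + of_nat n) = H x + of_nat n" if "H \<in> End1_real" for H x n
  proof (induction n)
    case (Suc n)
    have "H (x + of_nat (Suc n)) = H (x + of_nat n + 1)"
      by (simp add: add_ac)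
    then show ?case using that Suc by (simp add: End1_real_def)
  qed simp
  have shift_int: "H (x + of_int k) = H x + of_int k" if H: "H \<in> End1_real" for H x k
  proof (cases "k \<ge> 0")
    case True
    then show ?thesis using shift[OF H, of x "nat k"] by simp
  next
    case False
    then show ?thesis using shift[OF H, of "x + of_int k" "nat (- k)"] by simp
  qed
  have "continuous_on {0..1} (\<lambda>x. dist (F x) (G x))"
    using assms unfolding End1_real_def
    by (intro continuous_on_dist) (blast intro: continuous_on_subset)+
  then have "bounded ((\<lambda>x. dist (F x) (G x)) ` {0..1})"
    by (intro compact_imp_bounded compact_continuous_image) auto
  then obtain B where B: "\<And>x. x \<in> {0..1} \<Longrightarrow> dist (F x) (G x) \<le> B"
    unfolding bounded_iff by fastforce
  have "dist (F x) (G x) \<le> B" for x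
  proof -
    have "dist (F x) (G x) = dist (F (frac x)) (G (frac x))"
      using shift_int[OF assms(1), of "frac x" "\<lfloor>x\<rfloor>"] shift_int[OF assms(2), of "frac x" "\<lfloor>x\<rfloor>"]
      by (simp add: frac_def dist_real_def)
    moreover have "frac x \<in> {0..1}"
      using frac_ge_0[of x] frac_lt_1[of x] by simp
    ultimately show ?thesis
      using B by metis
  qed
  then show ?thesis by (rule bdd_aboveI2)
qed

lemma circle_bdd: "bdd_above (range (\<lambda>x. dist (f x) (g x :: circle)))"
proof (rule bdd_aboveI2)
  fix x
  obtain u v where "f x = proj u" "g x = proj v" using proj_surj by metis
  then show "dist (f x) (g x) \<le> 1 / 2"
    using of_int_round_abs_le[of "u - v"] by (simp add: dist_proj abs_minus_commute)
qed


section \<open>Random circle endomorphisms and their lifts\<close>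

locale ergodic_system = prob_space M for M :: "'w measure" +
  fixes \<sigma> :: "'w \<Rightarrow> 'w"
  assumes measurable_shift: "\<sigma> \<in> measurable M M"
    and measure_preserving: "distr M M \<sigma> = M"
    and ergodic: "\<And>A. A \<in> sets M \<Longrightarrow> \<sigma> -` A \<inter> space M = A \<Longrightarrow> prob A = 0 \<or> prob A = 1"

primrec cocycle :: "('w \<Rightarrow> 'w) \<Rightarrow> ('w \<Rightarrow> 'a \<Rightarrow> 'a) \<Rightarrow> nat \<Rightarrow> 'w \<Rightarrow> 'a \<Rightarrow> 'a" where
  "cocycle \<sigma> F 0 \<omega> = id"
| "cocycle \<sigma> F (Suc n) \<omega> = F ((\<sigma> ^^ n) \<omega>) \<circ> cocycle \<sigma> F n \<omega>"

definition random_circle_endomorphism :: "'w measure \<Rightarrow> ('w \<Rightarrow> circle \<Rightarrow> circle) \<Rightarrow> bool" where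
  "random_circle_endomorphism M f \<longleftrightarrow> f \<in> measurable M (sup_borel End1_circle)"

definition random_lift ::
    "'w measure \<Rightarrow> ('w \<Rightarrow> circle \<Rightarrow> circle) \<Rightarrow> ('w \<Rightarrow> real \<Rightarrow> real) \<Rightarrow> bool" where
  "random_lift M f F \<longleftrightarrow>
     F \<in> measurable M (sup_borel End1_real) \<and> (\<forall>\<omega>\<in>space M. proj \<circ> F \<omega> = f \<omega> \<circ> proj)"

definition integrable_End1 :: "'w measure \<Rightarrow> ('w \<Rightarrow> real \<Rightarrow> real) set" where
  "integrable_End1 M =
     {F. F \<in> measurable M (sup_borel End1_real) \<and> integrable M (\<lambda>\<omega>. sup_dist (F \<omega>) id)}"

definition lower_map :: "('w \<Rightarrow> real \<Rightarrow> real) \<Rightarrow> 'w \<Rightarrow> real \<Rightarrow> real" where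
  "lower_map F \<omega> x = (INF y\<in>{x..}. F \<omega> y)"

definition upper_map :: "('w \<Rightarrow> real \<Rightarrow> real) \<Rightarrow> 'w \<Rightarrow> real \<Rightarrow> real" where
  "upper_map F \<omega> x = (SUP y\<in>{..x}. F \<omega> y)"


section \<open>Rotation numbers\<close>

definition is_random_rotation_number ::
    "'w measure \<Rightarrow> ('w \<Rightarrow> 'w) \<Rightarrow> ('w \<Rightarrow> real \<Rightarrow> real) \<Rightarrow> ('w \<Rightarrow> real) \<Rightarrow> bool" where
  "is_random_rotation_number M \<sigma> G \<rho> \<longleftrightarrow>
     integrable M \<rho> \<and>
     (\<forall>x. AE \<omega> in M. (\<lambda>n. (cocycle \<sigma> G n \<omega> x - x) / real n) \<longlonglongrightarrow> \<rho> \<omega>)"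

text \<open>A random rotation number exists for integrable monotone \<open>G\<close> by a theorem of Li and Lu.
  It is determined only up to null sets, so one is chosen; by the lemma below the mean
  does not depend on the choice.\<close>

definition random_rotation_number ::
    "'w measure \<Rightarrow> ('w \<Rightarrow> 'w) \<Rightarrow> ('w \<Rightarrow> real \<Rightarrow> real) \<Rightarrow> 'w \<Rightarrow> real" where
  "random_rotation_number M \<sigma> G = (SOME \<rho>. is_random_rotation_number M \<sigma> G \<rho>)"

definition mean_rotation_number ::
    "'w measure \<Rightarrow> ('w \<Rightarrow> 'w) \<Rightarrow> ('w \<Rightarrow> real \<Rightarrow> real) \<Rightarrow> real" where
  "mean_rotation_number M \<sigma> G = (\<integral>\<omega>. random_rotation_number M \<sigma> G \<omega> \<partial>M)"

lemma mean_rotation_number_eq: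
  assumes "is_random_rotation_number M \<sigma> G \<rho>"
  shows "mean_rotation_number M \<sigma> G = (\<integral>\<omega>. \<rho> \<omega> \<partial>M)"
proof -
  let ?r = "random_rotation_number M \<sigma> G"
  have r: "is_random_rotation_number M \<sigma> G ?r"
    unfolding random_rotation_number_def using someI[of "is_random_rotation_number M \<sigma> G", OF assms] .
  have "AE \<omega> in M. (\<lambda>n. (cocycle \<sigma> G n \<omega> 0 - 0) / real n) \<longlonglongrightarrow> ?r \<omega>"
    and "AE \<omega> in M. (\<lambda>n. (cocycle \<sigma> G n \<omega> 0 - 0) / real n) \<longlonglongrightarrow> \<rho> \<omega>"
    using r assms unfolding is_random_rotation_number_def by blast+
  then have "AE \<omega> in M. ?r \<omega> = \<rho> \<omega>"
    by eventually_elim (rule LIMSEQ_unique)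
  moreover have "?r \<in> borel_measurable M" "\<rho> \<in> borel_measurable M"
    using r assms unfolding is_random_rotation_number_def by auto
  ultimately show ?thesis
    unfolding mean_rotation_number_def by (intro integral_cong_AE)
qed

end

theory Submission
  imports Defs
begin

text \<open>The image of a unit interval \<open>[y, y + 1]\<close> under \<open>F\<^sub>\<omega>\<close> is \<open>[F\<^sub>L y, F\<^sub>U y + 1]\<close>. Hence every
  sequence with \<open>y\<^sub>n\<^sub>+\<^sub>1\<close> between the lower and the upper map at \<open>y\<^sub>n\<close> is shadowed, up to distance 1,
  by a true orbit of \<open>F\<close>, and it remains to control such sequences. Moving at each time as close as
  the constraint permits to a target \<open>T\<^sub>n\<close> gives \<open>y\<^sub>n = T\<^sub>n + o(n)\<close> as soon as the slopes of \<open>T\<close> lie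
  between the rotation numbers of \<open>F\<^sub>L\<close> and \<open>F\<^sub>U\<close>; the target
  \<open>T\<^sub>n = n ((a + b) / 2 + (b - a) / 2 cos (\<pi> log\<^sub>2 log\<^sub>2 n))\<close> oscillates between slopes \<open>a\<close> and \<open>b\<close>.
  The rotation numbers exist, and are constant by ergodicity, because the displacement cocycle of a
  monotone degree-one map is additive up to an error of 1.\<close>

section \<open>The ergodic theorem of Birkhoff\<close>

lemma (in ergodic_system) shift_power_measurable [measurable]: "\<sigma> ^^ n \<in> measurable M M"
proof (induction n)
  case (Suc n)
  then show ?case using measurable_comp[OF Suc measurable_shift] by (simp add: comp_def)
qed simp

lemma (in ergodic_system) shift_power_space: "\<omega> \<in> space M \<Longrightarrow> (\<sigma> ^^ n) \<omega> \<in> space M"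
  using measurable_space[OF shift_power_measurable] .

lemma (in ergodic_system) integral_shift:
  fixes f :: "'w \<Rightarrow> real"
  assumes "f \<in> borel_measurable M"
  shows "(\<integral>\<omega>. f (\<sigma> \<omega>) \<partial>M) = (\<integral>\<omega>. f \<omega> \<partial>M)"
  using integral_distr[OF measurable_shift, of f] assms by (simp add: measure_preserving)

lemma (in ergodic_system) integrable_shift:
  fixes f :: "'w \<Rightarrow> real"
  assumes "integrable M f"
  shows "integrable M (\<lambda>\<omega>. f (\<sigma> \<omega>))"
  using integrable_distr[OF measurable_shift, of f] assms by (simp add: measure_preserving)

lemma (in ergodic_system) integrable_shift_power:
  fixes f :: "'w \<Rightarrow> real"
  assumes "integrable M f"
  shows "integrable M (\<lambda>\<omega>. f ((\<sigma> ^^ n) \<omega>))"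
proof (induction n)
  case (Suc n)
  then show ?case
    using integrable_shift[OF Suc] by (simp add: funpow_swap1)
qed (simp add: assms)

section \<open>Birkhoff sums and their running maxima\<close>

definition birkhoff_sum :: "('w \<Rightarrow> 'w) \<Rightarrow> ('w \<Rightarrow> real) \<Rightarrow> nat \<Rightarrow> 'w \<Rightarrow> real" where
  "birkhoff_sum \<sigma> f n \<omega> = (\<Sum>i<n. f ((\<sigma> ^^ i) \<omega>))"

lemma birkhoff_sum_0 [simp]: "birkhoff_sum \<sigma> f 0 \<omega> = 0"
  by (simp add: birkhoff_sum_def)

lemma birkhoff_sum_Suc: "birkhoff_sum \<sigma> f (Suc n) \<omega> = f \<omega> + birkhoff_sum \<sigma> f n (\<sigma> \<omega>)"
  unfolding birkhoff_sum_def by (simp only: sum.lessThan_Suc_shift) (simp add: funpow_swap1)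

text \<open>The largest of the Birkhoff sums of lengths 0 to n. The recursion through
  \<open>\<sigma> \<omega>\<close> makes Garsia's comparison with the maximum at the shifted point
  immediate.\<close>

primrec max_birkhoff_sum :: "('w \<Rightarrow> 'w) \<Rightarrow> ('w \<Rightarrow> real) \<Rightarrow> nat \<Rightarrow> 'w \<Rightarrow> real" where
  "max_birkhoff_sum \<sigma> f 0 \<omega> = 0"
| "max_birkhoff_sum \<sigma> f (Suc n) \<omega> = max 0 (f \<omega> + max_birkhoff_sum \<sigma> f n (\<sigma> \<omega>))"

lemma max_birkhoff_sum_nonneg: "0 \<le> max_birkhoff_sum \<sigma> f n \<omega>"
  by (cases n) auto

lemma max_birkhoff_sum_mono: "max_birkhoff_sum \<sigma> f n \<omega> \<le> max_birkhoff_sum \<sigma> f (Suc n) \<omega>"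
proof (induction n arbitrary: \<omega>)
  case (Suc n)
  show ?case using Suc[of "\<sigma> \<omega>"] by (simp add: max_def)
qed simp

lemma birkhoff_sum_le_max: "k \<le> n \<Longrightarrow> birkhoff_sum \<sigma> f k \<omega> \<le> max_birkhoff_sum \<sigma> f n \<omega>"
proof (induction n arbitrary: k \<omega>)
  case (Suc n)
  show ?case
  proof (cases k)
    case 0
    then show ?thesis using max_birkhoff_sum_nonneg[of \<sigma> f "Suc n" \<omega>] by simp
  next
    case (Suc j)
    then show ?thesis using Suc.IH[of j "\<sigma> \<omega>"] Suc.prems by (simp add: birkhoff_sum_Suc)
  qed
qed simp

lemma (in ergodic_system) birkhoff_sum_measurable [measurable (raw)]:
  assumes [measurable]: "f \<in> borel_measurable M"
  shows "birkhoff_sum \<sigma> f n \<in> borel_measurable M"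
  unfolding birkhoff_sum_def by measurable

lemma (in ergodic_system) integrable_max_birkhoff_sum:
  assumes "integrable M f"
  shows "integrable M (max_birkhoff_sum \<sigma> f n)"
proof (induction n)
  case (Suc n)
  show ?case using integrable_shift[OF Suc] assms by simp
qed simp

text \<open>Garsia's argument: were the sums unbounded on the invariant set \<open>A\<close> of full measure,
  then \<open>max_birkhoff_sum (Suc n) - max_birkhoff_sum n \<circ> \<sigma>\<close>, whose integral is non-negative,
  would converge to \<open>f\<close>.\<close>

lemma (in ergodic_system) birkhoff_sum_bdd_above:
  assumes f: "integrable M f" and neg: "(\<integral>\<omega>. f \<omega> \<partial>M) < 0"
  shows "AE \<omega> in M. \<exists>C. \<forall>n. birkhoff_sum \<sigma> f n \<omega> \<le> C"
proof -
  \<comment> \<open>Testing only natural bounds \<open>C\<close> keeps \<open>A\<close> a countable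
    combination of measurable sets.\<close>
  define A where "A = {\<omega> \<in> space M. \<forall>C::nat. \<exists>n. real C < birkhoff_sum \<sigma> f n \<omega>}"
  have fm [measurable]: "f \<in> borel_measurable M" using f by auto
  have A [measurable]: "A \<in> sets M"
    unfolding A_def by measurable
  \<comment> \<open>Dropping the first summand changes all sums by the fixed number
    \<open>f \<omega>\<close>, so unboundedness passes both ways. This makes \<open>A\<close>
    exactly invariant, as \<open>ergodic\<close> demands.\<close>
  have unbdd: "(\<forall>C::nat. \<exists>n. real C < birkhoff_sum \<sigma> f n (\<sigma> \<omega>)) \<longleftrightarrow>
      (\<forall>C::nat. \<exists>n. real C < birkhoff_sum \<sigma> f n \<omega>)" for \<omega>
  proof safe
    fix C :: nat
    assume *: "\<forall>C::nat. \<exists>n. real C < birkhoff_sum \<sigma> f n (\<sigma> \<omega>)"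
    obtain D :: nat where D: "real C - f \<omega> \<le> real D" using real_arch_simple by blast
    obtain n where "real D < birkhoff_sum \<sigma> f n (\<sigma> \<omega>)" using * by blast
    then have "real C < birkhoff_sum \<sigma> f (Suc n) \<omega>" using D by (simp add: birkhoff_sum_Suc)
    then show "\<exists>n. real C < birkhoff_sum \<sigma> f n \<omega>" by blast
  next
    fix C :: nat
    assume *: "\<forall>C::nat. \<exists>n. real C < birkhoff_sum \<sigma> f n \<omega>"
    obtain D :: nat where D: "real C + f \<omega> \<le> real D" using real_arch_simple by blast
    obtain n where n: "real D < birkhoff_sum \<sigma> f n \<omega>" using * by blast
    then have "n \<noteq> 0" by (metis birkhoff_sum_0 not_less of_nat_0_le_iff)
    then obtain k where "n = Suc k" by (cases n) auto
    then have "real C < birkhoff_sum \<sigma> f k (\<sigma> \<omega>)" using n D by (simp add: birkhoff_sum_Suc)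
    then show "\<exists>n. real C < birkhoff_sum \<sigma> f n (\<sigma> \<omega>)" by blast
  qed
  have inv: "\<sigma> -` A \<inter> space M = A"
    using unbdd measurable_space[OF measurable_shift] unfolding A_def by auto
  have "prob A \<noteq> 1"
  proof
    assume "prob A = 1"
    then have AE_A: "AE \<omega> in M. \<omega> \<in> A"
      using A by (simp add: prob_eq_1)
    define h where "h n \<omega> = max_birkhoff_sum \<sigma> f (Suc n) \<omega> - max_birkhoff_sum \<sigma> f n (\<sigma> \<omega>)" for n \<omega>
    \<comment> \<open>The first argument is non-positive, hence
      \<open>\<bar>h n \<omega>\<bar> \<le> \<bar>f \<omega>\<bar>\<close>; it is at most
      \<open>f \<omega>\<close> as soon as the maximum at \<open>\<sigma> \<omega>\<close> reaches
      \<open>- f \<omega>\<close>.\<close>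
    have h_eq: "h n \<omega> = max (- max_birkhoff_sum \<sigma> f n (\<sigma> \<omega>)) (f \<omega>)" for n \<omega>
      by (simp add: h_def)
    note int = integrable_max_birkhoff_sum[OF f]
    \<comment> \<open>Invariance of the integral removes the shift, and the maxima increase with
      n.\<close>
    have h_nonneg: "0 \<le> (\<integral>\<omega>. h n \<omega> \<partial>M)" for n
    proof -
      have "(\<integral>\<omega>. h n \<omega> \<partial>M) = (\<integral>\<omega>. max_birkhoff_sum \<sigma> f (Suc n) \<omega> \<partial>M) - (\<integral>\<omega>. max_birkhoff_sum \<sigma> f n (\<sigma> \<omega>) \<partial>M)"
        unfolding h_def by (rule Bochner_Integration.integral_diff[OF int[of "Suc n"] integrable_shift[OF int[of n]]])
      moreover have "(\<integral>\<omega>. max_birkhoff_sum \<sigma> f n (\<sigma> \<omega>) \<partial>M) = (\<integral>\<omega>. max_birkhoff_sum \<sigma> f n \<omega> \<partial>M)"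
        by (rule integral_shift) (rule borel_measurable_integrable[OF int])
      moreover have "(\<integral>\<omega>. max_birkhoff_sum \<sigma> f n \<omega> \<partial>M) \<le> (\<integral>\<omega>. max_birkhoff_sum \<sigma> f (Suc n) \<omega> \<partial>M)"
        by (rule integral_mono[OF int int]) (rule max_birkhoff_sum_mono)
      ultimately show ?thesis by linarith
    qed
    have "(\<lambda>n. \<integral>\<omega>. h n \<omega> \<partial>M) \<longlonglongrightarrow> (\<integral>\<omega>. f \<omega> \<partial>M)"
    proof (rule integral_dominated_convergence[where w = "\<lambda>\<omega>. \<bar>f \<omega>\<bar>"])
      show "h n \<in> borel_measurable M" for n
      proof -
        have "(\<lambda>\<omega>. max_birkhoff_sum \<sigma> f (Suc n) \<omega> - max_birkhoff_sum \<sigma> f n (\<sigma> \<omega>)) \<in> borel_measurable M"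
          by (rule borel_measurable_diff[OF borel_measurable_integrable[OF int]
                borel_measurable_integrable[OF integrable_shift[OF int]]])
        then show ?thesis by (simp only: h_def[abs_def])
      qed
      show "AE \<omega> in M. (\<lambda>n. h n \<omega>) \<longlonglongrightarrow> f \<omega>"
        using AE_A
      proof eventually_elim
        case (elim \<omega>)
        obtain C :: nat where C: "- f \<omega> \<le> real C" using real_arch_simple by blast
        obtain k where k: "real C < birkhoff_sum \<sigma> f k (\<sigma> \<omega>)"
          using elim unbdd[of \<omega>] unfolding A_def by blast
        have "h n \<omega> = f \<omega>" if "n \<ge> k" for n
          using birkhoff_sum_le_max[OF that, of \<sigma> f "\<sigma> \<omega>"] k C by (simp add: h_eq)
        then show ?case
          by (intro tendsto_eventually eventually_sequentiallyI[of k])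
      qed
      show "AE \<omega> in M. norm (h n \<omega>) \<le> \<bar>f \<omega>\<bar>" for n
      proof (rule AE_I2)
        show "norm (h n \<omega>) \<le> \<bar>f \<omega>\<bar>" for \<omega>
          using max_birkhoff_sum_nonneg[of \<sigma> f n "\<sigma> \<omega>"] by (auto simp: h_eq max_def)
      qed
    qed (use f in auto)
    then have "0 \<le> (\<integral>\<omega>. f \<omega> \<partial>M)"
      by (rule LIMSEQ_le_const) (use h_nonneg in blast)
    with neg show False by simp
  qed
  then have "prob A = 0" using ergodic[OF A inv] by simp
  then have "AE \<omega> in M. \<omega> \<notin> A" using A by (simp add: prob_eq_0)
  then show ?thesis
    using AE_space by eventually_elim (auto simp: A_def not_less)
qed

section \<open>Convergence of the Birkhoff averages\<close>

lemma birkhoff_sum_diff_const: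
  "birkhoff_sum \<sigma> (\<lambda>\<omega>. f \<omega> - c) n \<omega> = birkhoff_sum \<sigma> f n \<omega> - real n * c"
  by (simp add: birkhoff_sum_def sum_subtractf)

text \<open>After subtracting the mean plus half the tolerance the integral is negative, so the sums
  stay below some \<open>C\<close>; the other half of the tolerance absorbs \<open>C / n\<close>.
  Countably many tolerances share one null set.\<close>

lemma (in ergodic_system) birkhoff_upper:
  assumes f: "integrable M f"
  shows "AE \<omega> in M. \<forall>k. eventually (\<lambda>n. birkhoff_sum \<sigma> f n \<omega> / real n \<le>
    (\<integral>\<omega>. f \<omega> \<partial>M) + 1 / real (Suc k)) sequentially"
  unfolding AE_all_countable
proof
  fix k
  define e where "e = 1 / real (Suc k)"
  have e: "e > 0" by (simp add: e_def)
  let ?c = "(\<integral>\<omega>. f \<omega> \<partial>M) + e / 2"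
  have "(\<integral>\<omega>. f \<omega> - ?c \<partial>M) < 0"
    using f e by (simp add: Bochner_Integration.integral_diff prob_space)
  then have "AE \<omega> in M. \<exists>C. \<forall>n. birkhoff_sum \<sigma> (\<lambda>\<omega>. f \<omega> - ?c) n \<omega> \<le> C"
    using f by (intro birkhoff_sum_bdd_above) auto
  then have "AE \<omega> in M. eventually (\<lambda>n. birkhoff_sum \<sigma> f n \<omega> / real n \<le>
    (\<integral>\<omega>. f \<omega> \<partial>M) + e) sequentially"
  proof eventually_elim
    case (elim \<omega>)
    then obtain C where C: "\<And>n. birkhoff_sum \<sigma> f n \<omega> - real n * ?c \<le> C"
      unfolding birkhoff_sum_diff_const by blast
    have "(\<lambda>n. C / real n) \<longlonglongrightarrow> 0"
      by (rule lim_const_over_n)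
    then have "eventually (\<lambda>n. C / real n < e / 2) sequentially"
      by (rule order_tendstoD) (use e in simp)
    then show ?case
      using eventually_gt_at_top[of 0]
    proof eventually_elim
      case (elim n)
      have "birkhoff_sum \<sigma> f n \<omega> / real n \<le> (C + real n * ?c) / real n"
        using C[of n] by (intro divide_right_mono) auto
      also have "\<dots> = C / real n + ?c" using elim by (simp add: field_simps)
      finally show ?case using elim(1) by linarith
    qed
  qed
  then show "AE \<omega> in M. eventually (\<lambda>n. birkhoff_sum \<sigma> f n \<omega> / real n \<le>
    (\<integral>\<omega>. f \<omega> \<partial>M) + 1 / real (Suc k)) sequentially"
    by (simp only: e_def)
qed

text \<open>The upper estimates for \<open>f\<close> and for \<open>- f\<close> enclose the
  averages.\<close>

theorem (in ergodic_system) birkhoff_ergodic: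
  assumes f: "integrable M f"
  shows "AE \<omega> in M. (\<lambda>n. birkhoff_sum \<sigma> f n \<omega> / real n) \<longlonglongrightarrow> (\<integral>\<omega>. f \<omega> \<partial>M)"
proof -
  have neg: "birkhoff_sum \<sigma> (\<lambda>\<omega>. - f \<omega>) n \<omega> = - birkhoff_sum \<sigma> f n \<omega>" for n \<omega>
    by (simp add: birkhoff_sum_def sum_negf)
  have "integrable M (\<lambda>\<omega>. - f \<omega>)" using f by simp
  from birkhoff_upper[OF f] birkhoff_upper[OF this] show ?thesis
  proof eventually_elim
    case (elim \<omega>)
    show ?case
    proof (rule LIMSEQ_I)
      fix r :: real assume "r > 0"
      then obtain k where k: "1 / real (Suc k) < r"
        using nat_approx_posE by metis
      have "eventually (\<lambda>n. norm (birkhoff_sum \<sigma> f n \<omega> / real n - (\<integral>\<omega>. f \<omega> \<partial>M)) < r) sequentially"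
        using elim(1)[rule_format, of k] elim(2)[rule_format, of k]
        by eventually_elim (use k in \<open>auto simp: neg abs_if\<close>)
      then show "\<exists>N. \<forall>n\<ge>N. norm (birkhoff_sum \<sigma> f n \<omega> / real n - (\<integral>\<omega>. f \<omega> \<partial>M)) < r"
        by (simp add: eventually_sequentially)
    qed
  qed
qed


section \<open>Almost additive processes\<close>

text \<open>The term is the difference of two consecutive Birkhoff sums, whose averages have the
  same limit.\<close>

lemma (in ergodic_system) integrable_shift_power_over_n:
  assumes f: "integrable M f"
  shows "AE \<omega> in M. (\<lambda>n. f ((\<sigma> ^^ n) \<omega>) / real n) \<longlonglongrightarrow> 0"
  using birkhoff_ergodic[OF f]
proof eventually_elim
  case (elim \<omega>)
  let ?c = "\<integral>\<omega>. f \<omega> \<partial>M"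
  have "(\<lambda>n. birkhoff_sum \<sigma> f (Suc n) \<omega> / real (Suc n) * (real (Suc n) / real n) -
      birkhoff_sum \<sigma> f n \<omega> / real n) \<longlonglongrightarrow> ?c * 1 - ?c"
    by (intro tendsto_diff tendsto_mult LIMSEQ_Suc elim LIMSEQ_Suc_n_over_n)
  \<comment> \<open>This holds at n = 0 too, where every quotient by \<open>real n\<close> is
    zero.\<close>
  moreover have "birkhoff_sum \<sigma> f (Suc n) \<omega> / real (Suc n) * (real (Suc n) / real n) -
      birkhoff_sum \<sigma> f n \<omega> / real n = f ((\<sigma> ^^ n) \<omega>) / real n" for n
    by (simp add: birkhoff_sum_def diff_divide_distrib[symmetric] del: of_nat_Suc)
  ultimately show ?case by simp
qed

text \<open>Telescoping \<open>\<phi> k \<circ> \<sigma>\<^sup>i \<approx> \<phi> (i + k) - \<phi> i\<close> over \<open>i < n\<close> leaves \<open>k * \<phi> n\<close>.\<close>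

lemma almost_additive_birkhoff_sum:
  fixes \<phi> :: "nat \<Rightarrow> 'w \<Rightarrow> real"
  assumes aa: "\<And>m n. \<bar>\<phi> (m + n) \<omega> - \<phi> m \<omega> - \<phi> n ((\<sigma> ^^ m) \<omega>)\<bar> \<le> C"
  shows "\<bar>birkhoff_sum \<sigma> (\<phi> k) n \<omega> - real k * \<phi> n \<omega> - (\<Sum>j<k. \<phi> j ((\<sigma> ^^ n) \<omega>) - \<phi> j \<omega>)\<bar>
    \<le> (real n + real k) * C"
proof -
  \<comment> \<open>Both sides are the sum of \<open>\<phi>\<close> over the indices n to n + k - 1
    minus its sum over 0 to k - 1.\<close>
  have tel: "(\<Sum>i<n. \<phi> (i + k) \<omega> - \<phi> i \<omega>) = (\<Sum>j<k. \<phi> (n + j) \<omega> - \<phi> j \<omega>)"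
  proof (induction k)
    case (Suc k)
    have "(\<Sum>i<n. \<phi> (i + Suc k) \<omega> - \<phi> i \<omega>) =
        (\<Sum>i<n. (\<phi> (Suc i + k) \<omega> - \<phi> (i + k) \<omega>) + (\<phi> (i + k) \<omega> - \<phi> i \<omega>))"
      by simp
    also have "\<dots> = (\<phi> (n + k) \<omega> - \<phi> k \<omega>) + (\<Sum>i<n. \<phi> (i + k) \<omega> - \<phi> i \<omega>)"
      using sum_lessThan_telescope[of "\<lambda>i. \<phi> (i + k) \<omega>" n] unfolding sum.distrib by simp
    finally show ?case using Suc by simp
  qed simp
  \<comment> \<open>Splitting at time i costs \<open>C\<close> for each of the n summands.\<close>
  have 1: "\<bar>birkhoff_sum \<sigma> (\<phi> k) n \<omega> - (\<Sum>i<n. \<phi> (i + k) \<omega> - \<phi> i \<omega>)\<bar> \<le> real n * C"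
  proof -
    have "\<bar>birkhoff_sum \<sigma> (\<phi> k) n \<omega> - (\<Sum>i<n. \<phi> (i + k) \<omega> - \<phi> i \<omega>)\<bar> =
        \<bar>\<Sum>i<n. \<phi> k ((\<sigma> ^^ i) \<omega>) - (\<phi> (i + k) \<omega> - \<phi> i \<omega>)\<bar>"
      by (simp add: birkhoff_sum_def sum_subtractf)
    also have "\<dots> \<le> (\<Sum>i<n. \<bar>\<phi> k ((\<sigma> ^^ i) \<omega>) - (\<phi> (i + k) \<omega> - \<phi> i \<omega>)\<bar>)"
      by (rule sum_abs)
    also have "\<dots> \<le> (\<Sum>i<n. C)"
    proof (rule sum_mono)
      show "\<bar>\<phi> k ((\<sigma> ^^ i) \<omega>) - (\<phi> (i + k) \<omega> - \<phi> i \<omega>)\<bar> \<le> C" for i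
        using aa[of i k] by linarith
    qed
    finally show ?thesis by simp
  qed
  \<comment> \<open>Splitting at time n costs \<open>C\<close> for each of the k summands and
    produces \<open>k * \<phi> n\<close>.\<close>
  have 2: "\<bar>(\<Sum>j<k. \<phi> (n + j) \<omega> - \<phi> j \<omega>) - real k * \<phi> n \<omega> - (\<Sum>j<k. \<phi> j ((\<sigma> ^^ n) \<omega>) - \<phi> j \<omega>)\<bar>
      \<le> real k * C"
  proof -
    have "(\<Sum>j<k. \<phi> (n + j) \<omega> - \<phi> j \<omega>) - real k * \<phi> n \<omega> - (\<Sum>j<k. \<phi> j ((\<sigma> ^^ n) \<omega>) - \<phi> j \<omega>) =
        (\<Sum>j<k. \<phi> (n + j) \<omega> - \<phi> n \<omega> - \<phi> j ((\<sigma> ^^ n) \<omega>))"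
      by (simp add: sum_subtractf)
    also have "\<bar>\<dots>\<bar> \<le> (\<Sum>j<k. \<bar>\<phi> (n + j) \<omega> - \<phi> n \<omega> - \<phi> j ((\<sigma> ^^ n) \<omega>)\<bar>)"
      by (rule sum_abs)
    also have "\<dots> \<le> (\<Sum>j<k. C)"
      by (intro sum_mono aa)
    finally show ?thesis by simp
  qed
  show ?thesis
    using 1 2 unfolding tel by (simp add: distrib_right)
qed

text \<open>Divide the preceding estimate by n: the averages of \<open>\<phi> k\<close> tend to its
  integral and the boundary terms vanish. An error of \<open>C\<close> plus a null sequence is left,
  for which the added 1 makes room; division by k finishes.\<close>

lemma (in ergodic_system) almost_additive_near:
  fixes \<phi> :: "nat \<Rightarrow> 'w \<Rightarrow> real"
  assumes int: "\<And>n. integrable M (\<phi> n)"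
    and aa: "\<And>m n \<omega>. \<omega> \<in> space M \<Longrightarrow> \<bar>\<phi> (m + n) \<omega> - \<phi> m \<omega> - \<phi> n ((\<sigma> ^^ m) \<omega>)\<bar> \<le> C"
    and k: "k > 0"
  shows "AE \<omega> in M. eventually (\<lambda>n. \<bar>\<phi> n \<omega> / real n - (\<integral>\<omega>. \<phi> k \<omega> \<partial>M) / real k\<bar> \<le> (C + 1) / real k)
    sequentially"
proof -
  have "AE \<omega> in M. \<forall>j. (\<lambda>n. \<phi> j ((\<sigma> ^^ n) \<omega>) / real n) \<longlonglongrightarrow> 0"
    unfolding AE_all_countable using integrable_shift_power_over_n[OF int] by blast
  then show ?thesis
    using birkhoff_ergodic[OF int[of k]] AE_space
  proof eventually_elim
    case (elim \<omega>)
    let ?c = "\<integral>\<omega>. \<phi> k \<omega> \<partial>M"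
    define S where "S n = birkhoff_sum \<sigma> (\<phi> k) n \<omega>" for n
    define R where "R n = (\<Sum>j<k. \<phi> j ((\<sigma> ^^ n) \<omega>) - \<phi> j \<omega>)" for n
    have bound: "\<bar>S n - real k * \<phi> n \<omega> - R n\<bar> \<le> (real n + real k) * C" for n
      unfolding S_def R_def by (rule almost_additive_birkhoff_sum) (rule aa[OF elim(3)])
    have "(\<lambda>n. \<Sum>j<k. \<phi> j ((\<sigma> ^^ n) \<omega>) / real n - \<phi> j \<omega> / real n) \<longlonglongrightarrow> (\<Sum>j<k. 0 - 0)"
      by (intro tendsto_sum tendsto_diff lim_const_over_n elim(1)[rule_format])
    then have R: "(\<lambda>n. R n / real n) \<longlonglongrightarrow> 0"
      by (simp add: R_def sum_divide_distrib diff_divide_distrib)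
    have "(\<lambda>n. \<bar>S n / real n - ?c\<bar> + \<bar>R n / real n\<bar> + (real k * C) / real n) \<longlonglongrightarrow> \<bar>?c - ?c\<bar> + \<bar>0\<bar> + 0"
      using elim(2) unfolding S_def[symmetric]
      by (intro tendsto_add tendsto_rabs tendsto_diff lim_const_over_n tendsto_const R)
    then have "eventually (\<lambda>n. \<bar>S n / real n - ?c\<bar> + \<bar>R n / real n\<bar> + (real k * C) / real n < 1) sequentially"
      by (intro order_tendstoD) auto
    then show ?case
      using eventually_gt_at_top[of 0]
    proof eventually_elim
      case (elim n)
      have "\<bar>S n / real n - real k * (\<phi> n \<omega> / real n) - R n / real n\<bar> = \<bar>S n - real k * \<phi> n \<omega> - R n\<bar> / real n"
        by (simp add: diff_divide_distrib[symmetric] abs_divide)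
      also have "\<dots> \<le> ((real n + real k) * C) / real n"
        using bound[of n] by (rule divide_right_mono) simp
      also have "\<dots> = C + (real k * C) / real n"
        using elim by (simp add: field_simps)
      finally have "\<bar>real k * (\<phi> n \<omega> / real n) - ?c\<bar> \<le> C + 1"
        using elim by linarith
      moreover have "\<bar>\<phi> n \<omega> / real n - ?c / real k\<bar> = \<bar>real k * (\<phi> n \<omega> / real n) - ?c\<bar> / real k"
      proof -
        have "\<phi> n \<omega> / real n - ?c / real k = (real k * (\<phi> n \<omega> / real n) - ?c) / real k"
          using k by (simp add: diff_divide_distrib)
        then show ?thesis by (simp only: abs_divide abs_of_nat)
      qed
      ultimately show ?case
        by (simp add: divide_right_mono)
    qed
  qed
qed

text \<open>The quotients are eventually within \<open>e k\<close> of \<open>d k\<close> for every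
  k. Comparing two indices shows that \<open>d\<close> is Cauchy, and its limit is the limit of the
  quotients.\<close>

theorem (in ergodic_system) almost_additive_ergodic:
  fixes \<phi> :: "nat \<Rightarrow> 'w \<Rightarrow> real"
  assumes int: "\<And>n. integrable M (\<phi> n)"
    and aa: "\<And>m n \<omega>. \<omega> \<in> space M \<Longrightarrow> \<bar>\<phi> (m + n) \<omega> - \<phi> m \<omega> - \<phi> n ((\<sigma> ^^ m) \<omega>)\<bar> \<le> C"
  obtains c where "AE \<omega> in M. (\<lambda>n. \<phi> n \<omega> / real n) \<longlonglongrightarrow> c"
proof -
  define d where "d k = (\<integral>\<omega>. \<phi> (Suc k) \<omega> \<partial>M) / real (Suc k)" for k
  define e where "e k = (C + 1) / real (Suc k)" for k
  have e: "e \<longlonglongrightarrow> 0"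
    unfolding e_def by (rule LIMSEQ_Suc[OF lim_const_over_n])
  have near: "AE \<omega> in M. \<forall>k. eventually (\<lambda>n. \<bar>\<phi> n \<omega> / real n - d k\<bar> \<le> e k) sequentially"
    unfolding AE_all_countable d_def e_def by (intro allI almost_additive_near int aa) auto
  have close: "\<bar>d k - d l\<bar> \<le> e k + e l" for k l
  proof -
    \<comment> \<open>The claim involves neither \<open>\<omega>\<close> nor n. It follows from one
      good \<open>\<omega>\<close> and one large n, as neither filter is trivial.\<close>
    from near have "AE \<omega> in M. \<bar>d k - d l\<bar> \<le> e k + e l"
    proof eventually_elim
      case (elim \<omega>)
      have "eventually (\<lambda>n. \<bar>d k - d l\<bar> \<le> e k + e l) (sequentially :: nat filter)"
        using elim[rule_format, of k] elim[rule_format, of l] by eventually_elim linarith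
      then show ?case by simp
    qed
    then show ?thesis by simp
  qed
  have "Cauchy d"
  proof (rule metric_CauchyI)
    fix r :: real assume "r > 0"
    then have "eventually (\<lambda>k. e k < r / 2) sequentially"
      using e by (intro order_tendstoD) auto
    then obtain K where K: "\<And>k. k \<ge> K \<Longrightarrow> e k < r / 2"
      by (auto simp: eventually_sequentially)
    have "dist (d m) (d n) < r" if "m \<ge> K" "n \<ge> K" for m n
      using close[of m n] K[OF that(1)] K[OF that(2)] by (simp add: dist_real_def)
    then show "\<exists>K. \<forall>m\<ge>K. \<forall>n\<ge>K. dist (d m) (d n) < r" by blast
  qed
  then obtain c where c: "d \<longlonglongrightarrow> c"
    using Cauchy_convergent_iff convergent_def by blast
  have "AE \<omega> in M. (\<lambda>n. \<phi> n \<omega> / real n) \<longlonglongrightarrow> c"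
    using near
  proof eventually_elim
    case (elim \<omega>)
    show ?case
    proof (rule tendstoI)
      fix r :: real assume "r > 0"
      have "(\<lambda>k. e k + \<bar>d k - c\<bar>) \<longlonglongrightarrow> 0 + \<bar>c - c\<bar>"
        by (intro tendsto_intros e c)
      then have "eventually (\<lambda>k. e k + \<bar>d k - c\<bar> < r) sequentially"
        using \<open>r > 0\<close> by (intro order_tendstoD) auto
      then obtain k where k: "e k + \<bar>d k - c\<bar> < r"
        by (auto simp: eventually_sequentially)
      show "eventually (\<lambda>n. dist (\<phi> n \<omega> / real n) c < r) sequentially"
        using elim[rule_format, of k] by eventually_elim (use k in \<open>auto simp: dist_real_def\<close>)
    qed
  qed
  then show thesis by (rule that)
qed


section \<open>Tracking a target between two monotone systems\<close>

text \<open>Tracking compares time n with an unknown earlier time m, so the o(n) error is needed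
  uniformly in m. The finitely many small m are bounded by a constant, which
  \<open>\<epsilon> * n\<close> outgrows.\<close>

lemma tendsto_0_running_max:
  fixes d :: "nat \<Rightarrow> real"
  assumes d: "(\<lambda>n. d n / real n) \<longlonglongrightarrow> 0" and "\<epsilon> > 0"
  shows "eventually (\<lambda>n. \<forall>m\<le>n. \<bar>d m\<bar> \<le> \<epsilon> * real n) sequentially"
proof -
  have "eventually (\<lambda>n. norm (d n / real n) < \<epsilon>) sequentially"
    using order_tendstoD(2)[OF tendsto_norm_zero[OF d] \<open>\<epsilon> > 0\<close>] .
  then obtain N where N: "\<And>n. n \<ge> N \<Longrightarrow> norm (d n / real n) < \<epsilon>"
    by (auto simp: eventually_sequentially)
  define B where "B = (\<Sum>m<Suc N. \<bar>d m\<bar>)"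
  obtain K :: nat where K: "B / \<epsilon> \<le> real K" using real_arch_simple by blast
  have "\<bar>d m\<bar> \<le> \<epsilon> * real n" if "n \<ge> K" "m \<le> n" for m n
  proof (cases "m \<le> N")
    case True
    then have "\<bar>d m\<bar> \<le> B"
      unfolding B_def by (intro member_le_sum) auto
    also have "B \<le> \<epsilon> * real K" using K \<open>\<epsilon> > 0\<close> by (simp add: field_simps)
    also have "\<dots> \<le> \<epsilon> * real n" using that \<open>\<epsilon> > 0\<close> by simp
    finally show ?thesis .
  next
    case False
    then have "\<bar>d m\<bar> \<le> \<epsilon> * real m"
      using N[of m] by (simp add: field_simps abs_divide)
    also have "\<dots> \<le> \<epsilon> * real n" using that \<open>\<epsilon> > 0\<close> by simp
    finally show ?thesis .
  qed
  then show ?thesis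
    by (intro eventually_sequentiallyI[of K]) blast
qed

section \<open>Orbits under sequences of monotone degree-one maps\<close>

definition mono_deg1 :: "(real \<Rightarrow> real) \<Rightarrow> bool" where
  "mono_deg1 g \<longleftrightarrow> mono g \<and> (\<forall>x. g (x + 1) = g x + 1)"

lemma deg1_add_nat:
  fixes g :: "real \<Rightarrow> real"
  assumes "\<And>x. g (x + 1) = g x + 1"
  shows "g (x + real n) = g x + real n"
proof (induction n)
  case (Suc n)
  then show ?case using assms[of "x + real n"] by (simp add: add_ac)
qed simp

lemma deg1_add_int:
  fixes g :: "real \<Rightarrow> real"
  assumes "\<And>x. g (x + 1) = g x + 1"
  shows "g (x + of_int k) = g x + of_int k"
proof (cases "k \<ge> 0")
  case True
  then show ?thesis using deg1_add_nat[of g, OF assms, of x "nat k"] by simp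
next
  case False
  then show ?thesis using deg1_add_nat[of g, OF assms, of "x + of_int k" "nat (- k)"] by simp
qed

text \<open>Squeeze x between two neighbouring integer translates of y, which g carries along
  rigidly.\<close>

lemma mono_deg1_diff:
  assumes "mono_deg1 g"
  shows "\<bar>(g x - g y) - (x - y)\<bar> \<le> 1"
proof -
  let ?k = "\<lfloor>x - y\<rfloor>"
  have deg: "\<And>x. g (x + 1) = g x + 1" and "mono g" using assms by (auto simp: mono_deg1_def)
  have "g (y + of_int ?k) \<le> g x" "g x \<le> g (y + of_int (?k + 1))"
    by (rule monoD[OF \<open>mono g\<close>]; linarith)+
  then show ?thesis
    unfolding deg1_add_int[of g, OF deg] by linarith
qed

lemma mono_deg1_comp: "mono_deg1 g \<Longrightarrow> mono_deg1 h \<Longrightarrow> mono_deg1 (g \<circ> h)"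
  by (auto simp: mono_deg1_def mono_def)

lemma mono_deg1_id: "mono_deg1 id"
  by (simp add: mono_deg1_def mono_def)

primrec orbit :: "(nat \<Rightarrow> real \<Rightarrow> real) \<Rightarrow> nat \<Rightarrow> real" where
  "orbit G 0 = 0"
| "orbit G (Suc n) = G n (orbit G n)"

text \<open>From time m to n both sequences are moved by one and the same composition, which is
  again monotone of degree one.\<close>

lemma orbit_segment:
  assumes G: "\<And>n. mono_deg1 (G n)"
    and y: "\<And>k. m \<le> k \<Longrightarrow> k < n \<Longrightarrow> y (Suc k) = G k (y k)" and "m \<le> n"
  shows "\<bar>(y n - y m) - (orbit G n - orbit G m)\<bar> \<le> 1"
proof -
  have "\<exists>g. mono_deg1 g \<and> y n = g (y m) \<and> orbit G n = g (orbit G m)"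
    using \<open>m \<le> n\<close> y
  proof (induction n rule: dec_induct)
    case base
    then show ?case using mono_deg1_id by force
  next
    case (step n)
    then obtain g where "mono_deg1 g" "y n = g (y m)" "orbit G n = g (orbit G m)"
      by auto
    then show ?case
      using mono_deg1_comp[OF G[of n], of g] step.prems[of n] step.hyps
      by (intro exI[of _ "G n \<circ> g"]) (auto simp: comp_def)
  qed
  then show ?thesis using mono_deg1_diff[of _ "y m" "orbit G m"] by fastforce
qed

text \<open>The next target value is projected onto the interval between the two maps at the current
  point.\<close>

primrec tracking :: "(nat \<Rightarrow> real \<Rightarrow> real) \<Rightarrow> (nat \<Rightarrow> real \<Rightarrow> real) \<Rightarrow> (nat \<Rightarrow> real) \<Rightarrow> nat \<Rightarrow> real" where
  "tracking G H T 0 = T 0"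
| "tracking G H T (Suc n) =
    max (G n (tracking G H T n)) (min (H n (tracking G H T n)) (T (Suc n)))"

text \<open>Since the last time \<open>m\<close> at which the tracking sequence was not above its target, it has been
  an orbit of the lower maps.\<close>

lemma tracking_upper:
  assumes G: "\<And>n. mono_deg1 (G n)" and GH: "\<And>n x. G n x \<le> H n x"
  shows "\<exists>m\<le>n. tracking G H T n \<le> T m + (orbit G n - orbit G m) + 1"
proof -
  let ?y = "tracking G H T"
  define m where "m = Max {m. m \<le> n \<and> ?y m \<le> T m}"
  have fin: "finite {m. m \<le> n \<and> ?y m \<le> T m}" by simp
  \<comment> \<open>The sequence starts on its target, so the maximum is taken over a nonempty
    set.\<close>
  have "0 \<in> {m. m \<le> n \<and> ?y m \<le> T m}" by simp
  then have "m \<in> {m. m \<le> n \<and> ?y m \<le> T m}"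
    unfolding m_def by (intro Max_in fin) blast
  then have m: "m \<le> n" "?y m \<le> T m" by auto
  have above: "T k < ?y k" if "m < k" "k \<le> n" for k
    using Max_ge[OF fin, of k] that unfolding m_def[symmetric] by force
  \<comment> \<open>The inner minimum never exceeds the target, so a value above the target must
    come from \<open>G\<close>.\<close>
  have "?y (Suc k) = G k (?y k)" if "m \<le> k" "k < n" for k
    using above[of "Suc k"] that by (auto simp: max_def min_def split: if_splits)
  from orbit_segment[of G, OF G this m(1)] m show ?thesis
    by (intro exI[of _ m]) auto
qed

text \<open>Mirror image: since the last time at or above the target, the sequence has been an orbit
  of the upper maps.\<close>

lemma tracking_lower:
  assumes H: "\<And>n. mono_deg1 (H n)" and GH: "\<And>n x. G n x \<le> H n x"
  shows "\<exists>m\<le>n. tracking G H T n \<ge> T m + (orbit H n - orbit H m) - 1"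
proof -
  let ?y = "tracking G H T"
  define m where "m = Max {m. m \<le> n \<and> ?y m \<ge> T m}"
  have fin: "finite {m. m \<le> n \<and> ?y m \<ge> T m}" by simp
  have "0 \<in> {m. m \<le> n \<and> ?y m \<ge> T m}" by simp
  then have "m \<in> {m. m \<le> n \<and> ?y m \<ge> T m}"
    unfolding m_def by (intro Max_in fin) blast
  then have m: "m \<le> n" "?y m \<ge> T m" by auto
  have below: "T k > ?y k" if "m < k" "k \<le> n" for k
    using Max_ge[OF fin, of k] that unfolding m_def[symmetric] by force
  have "?y (Suc k) = H k (?y k)" if "m \<le> k" "k < n" for k
    using below[of "Suc k"] that GH[of k "?y k"] by (auto simp: max_def min_def split: if_splits)
  from orbit_segment[of H, OF H this m(1)] m show ?thesis
    by (intro exI[of _ m]) auto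
qed

lemma tracking_between:
  assumes GH: "\<And>n x. G n x \<le> H n x"
  shows "tracking G H T (Suc n) \<in> {G n (tracking G H T n) .. H n (tracking G H T n)}"
  using GH[of n "tracking G H T n"] by auto

text \<open>Since time m the lower orbit has moved by l (n - m) + o(n), and the target by at least
  as much up to o(n); so the sequence cannot end far above its target. The upper orbit excludes the
  other side.\<close>

lemma tracking_asymptotic:
  assumes G: "\<And>n. mono_deg1 (G n)" and H: "\<And>n. mono_deg1 (H n)" and GH: "\<And>n x. G n x \<le> H n x"
    and l: "(\<lambda>n. orbit G n / real n) \<longlonglongrightarrow> l" and u: "(\<lambda>n. orbit H n / real n) \<longlonglongrightarrow> u"
    and T: "\<And>\<epsilon>. \<epsilon> > 0 \<Longrightarrow> eventually (\<lambda>n. \<forall>m\<le>n.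
      T n - T m \<in> {l * (real n - real m) - \<epsilon> * real n .. u * (real n - real m) + \<epsilon> * real n}) sequentially"
  shows "(\<lambda>n. (tracking G H T n - T n) / real n) \<longlonglongrightarrow> 0"
proof (rule tendstoI)
  fix r :: real assume "r > 0"
  \<comment> \<open>Four errors below \<open>e * n\<close> arise: the orbit deviations at n and at
    m, the slack of the target, and the constant 1.\<close>
  define e where "e = r / 5"
  have e: "e > 0" using \<open>r > 0\<close> by (simp add: e_def)
  have dev: "(\<lambda>n. (orbit K n - c * real n) / real n) \<longlonglongrightarrow> 0" if "(\<lambda>n. orbit K n / real n) \<longlonglongrightarrow> c" for K c
  proof (rule Lim_transform_eventually)
    show "(\<lambda>n. orbit K n / real n - c) \<longlonglongrightarrow> 0"
      using that by (simp add: LIM_zero)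
    show "eventually (\<lambda>n. orbit K n / real n - c = (orbit K n - c * real n) / real n) sequentially"
      using eventually_gt_at_top[of 0] by eventually_elim (simp add: field_simps)
  qed
  have "eventually (\<lambda>n. 1 / real n < e) sequentially"
    by (rule order_tendstoD[OF lim_const_over_n]) (rule e)
  then show "eventually (\<lambda>n. dist ((tracking G H T n - T n) / real n) 0 < r) sequentially"
    using tendsto_0_running_max[OF dev[OF l] e] tendsto_0_running_max[OF dev[OF u] e] T[OF e]
      eventually_gt_at_top[of 0]
  proof eventually_elim
    case (elim n)
    have one: "1 < e * real n" using elim by (simp add: field_simps)
    obtain m where m: "m \<le> n" "tracking G H T n \<le> T m + (orbit G n - orbit G m) + 1"
      using tracking_upper[of G H n T, OF G GH] by blast
    have "tracking G H T n - T n < 4 * e * real n"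
      using m elim(2)[rule_format, of n] elim(2)[rule_format, of m] elim(4)[rule_format, of m] one
      by (auto simp: algebra_simps abs_le_iff)
    moreover obtain k where k: "k \<le> n" "tracking G H T n \<ge> T k + (orbit H n - orbit H k) - 1"
      using tracking_lower[of H G n T, OF H GH] by blast
    have "T n - tracking G H T n < 4 * e * real n"
      using k elim(3)[rule_format, of n] elim(3)[rule_format, of k] elim(4)[rule_format, of k] one
      by (auto simp: algebra_simps abs_le_iff)
    ultimately have "\<bar>tracking G H T n - T n\<bar> < r * real n"
      using one \<open>r > 0\<close> by (auto simp: e_def)
    then show ?case using elim(5) by (simp add: abs_divide field_simps)
  qed
qed


section \<open>Lower and upper maps\<close>

text \<open>Conjugation by x to -x exchanges lower and upper maps, so facts on upper maps follow
  from those on lower maps.\<close>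

definition reflect :: "('w \<Rightarrow> real \<Rightarrow> real) \<Rightarrow> 'w \<Rightarrow> real \<Rightarrow> real" where
  "reflect F \<omega> x = - F \<omega> (- x)"

lemma End1_real_continuous: "f \<in> End1_real \<Longrightarrow> continuous_on A f"
  by (auto simp: End1_real_def intro: continuous_on_subset)

lemma End1_real_deg: "f \<in> End1_real \<Longrightarrow> f (x + 1) = f x + 1"
  by (simp add: End1_real_def)

lemma reflect_End1: "F \<omega> \<in> End1_real \<Longrightarrow> reflect F \<omega> \<in> End1_real"
proof -
  assume F: "F \<omega> \<in> End1_real"
  have "continuous_on UNIV (\<lambda>x. - F \<omega> (- x))"
    using End1_real_continuous[OF F]
    by (intro continuous_on_minus continuous_on_compose2[of UNIV "F \<omega>" UNIV uminus] continuous_on_id) auto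
  moreover have "- F \<omega> (- (x + 1)) = - F \<omega> (- x) + 1" for x
    using End1_real_deg[OF F, of "- (x + 1)"] by simp
  ultimately show ?thesis
    unfolding End1_real_def reflect_def[abs_def] by blast
qed

text \<open>A minimum over one period exists by compactness. Any point further right is moved back
  into that period by an integer, which only decreases the value.\<close>

lemma lower_map_attained:
  assumes F: "F \<omega> \<in> End1_real"
  obtains p where "p \<in> {x..x + 1}" "F \<omega> p = lower_map F \<omega> x" "\<And>q. x \<le> q \<Longrightarrow> F \<omega> p \<le> F \<omega> q"
proof -
  obtain p where p: "p \<in> {x..x + 1}" "\<And>q. q \<in> {x..x + 1} \<Longrightarrow> F \<omega> p \<le> F \<omega> q"
    using continuous_attains_inf[OF _ _ End1_real_continuous[OF F], of "{x..x + 1}"] by auto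
  have min: "F \<omega> p \<le> F \<omega> q" if "x \<le> q" for q
  proof -
    let ?n = "nat \<lfloor>q - x\<rfloor>"
    have "real ?n = of_int \<lfloor>q - x\<rfloor>" using that by simp
    then have "q - real ?n \<in> {x..x + 1}" unfolding atLeastAtMost_iff by linarith
    then have "F \<omega> p \<le> F \<omega> (q - real ?n)" by (rule p(2))
    also have "\<dots> \<le> F \<omega> q"
      using deg1_add_nat[of "F \<omega>" "q - real ?n" ?n, OF End1_real_deg[OF F]] by simp
    finally show ?thesis .
  qed
  have "lower_map F \<omega> x = F \<omega> p"
    unfolding lower_map_def by (rule cInf_eq_minimum) (use p min in auto)
  with p min show thesis by (intro that) auto
qed

lemma upper_map_attained:
  assumes F: "F \<omega> \<in> End1_real"
  obtains p where "p \<in> {x - 1..x}" "F \<omega> p = upper_map F \<omega> x" "\<And>q. q \<le> x \<Longrightarrow> F \<omega> q \<le> F \<omega> p"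
proof -
  obtain p where p: "p \<in> {- x..- x + 1}" "\<And>q. - x \<le> q \<Longrightarrow> reflect F \<omega> p \<le> reflect F \<omega> q"
    using lower_map_attained[of "reflect F" \<omega> "- x", OF reflect_End1[of F, OF F]] by metis
  have max: "F \<omega> q \<le> F \<omega> (- p)" if "q \<le> x" for q
    using p(2)[of "- q"] that by (simp add: reflect_def)
  have "upper_map F \<omega> x = F \<omega> (- p)"
    unfolding upper_map_def by (rule cSup_eq_maximum) (use p max in auto)
  with p max show thesis by (intro that[of "- p"]) auto
qed

lemma upper_map_eq_reflect:
  assumes F: "F \<omega> \<in> End1_real"
  shows "upper_map F \<omega> x = - lower_map (reflect F) \<omega> (- x)"
proof -
  obtain p where p: "p \<in> {x - 1..x}" "F \<omega> p = upper_map F \<omega> x" "\<And>q. q \<le> x \<Longrightarrow> F \<omega> q \<le> F \<omega> p"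
    using upper_map_attained[of F \<omega> x, OF F] by metis
  obtain r where r: "r \<in> {- x..- x + 1}" "reflect F \<omega> r = lower_map (reflect F) \<omega> (- x)"
      "\<And>q. - x \<le> q \<Longrightarrow> reflect F \<omega> r \<le> reflect F \<omega> q"
    using lower_map_attained[of "reflect F" \<omega> "- x", OF reflect_End1[of F, OF F]] by metis
  show ?thesis
    using p(3)[of "- r"] r(3)[of "- p"] p(1,2) r(1,2) by (auto simp: reflect_def)
qed

lemma lower_map_mono_deg1:
  assumes F: "F \<omega> \<in> End1_real"
  shows "mono_deg1 (lower_map F \<omega>)"
proof -
  have le: "lower_map F \<omega> x \<le> F \<omega> q" if "x \<le> q" for x q
    using lower_map_attained[of F \<omega> x, OF F] that by metis
  have mono: "lower_map F \<omega> x \<le> lower_map F \<omega> y" if "x \<le> y" for x y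
    using lower_map_attained[of F \<omega> y, OF F] le[of x] that by (metis atLeastAtMost_iff order.trans)
  have "lower_map F \<omega> (x + 1) = lower_map F \<omega> x + 1" for x
  proof (rule antisym)
    obtain p where "p \<in> {x..x + 1}" "F \<omega> p = lower_map F \<omega> x"
      using lower_map_attained[of F \<omega> x, OF F] by metis
    then show "lower_map F \<omega> (x + 1) \<le> lower_map F \<omega> x + 1"
      using le[of "x + 1" "p + 1"] End1_real_deg[OF F, of p] by auto
    obtain p where "p \<in> {x + 1..x + 1 + 1}" "F \<omega> p = lower_map F \<omega> (x + 1)"
      using lower_map_attained[of F \<omega> "x + 1", OF F] by metis
    then show "lower_map F \<omega> x + 1 \<le> lower_map F \<omega> (x + 1)"
      using le[of x "p - 1"] End1_real_deg[OF F, of "p - 1"] by auto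
  qed
  with mono show ?thesis by (auto simp: mono_deg1_def intro: monoI)
qed

lemma upper_map_mono_deg1:
  assumes F: "F \<omega> \<in> End1_real"
  shows "mono_deg1 (upper_map F \<omega>)"
proof -
  have L: "mono (lower_map (reflect F) \<omega>)" "lower_map (reflect F) \<omega> (x + 1) = lower_map (reflect F) \<omega> x + 1" for x
    using lower_map_mono_deg1[of "reflect F", OF reflect_End1[of F, OF F]] by (auto simp: mono_deg1_def)
  show ?thesis
    unfolding mono_deg1_def upper_map_eq_reflect[of F, OF F]
    using L(2)[of "- (x + 1)" for x] by (auto intro!: monoI monoD[OF L(1)])
qed

lemma lower_le_upper_map:
  assumes F: "F \<omega> \<in> End1_real"
  shows "lower_map F \<omega> x \<le> upper_map F \<omega> x"
  using lower_map_attained[of F \<omega> x, OF F] upper_map_attained[of F \<omega> x, OF F]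
  by (metis order.refl order.trans)

text \<open>Both end values are attained in the same unit interval: the upper map at x + 1 is a
  maximum over its left neighbours down to x.\<close>

lemma lower_upper_image:
  assumes F: "F \<omega> \<in> End1_real" and z: "z \<in> {lower_map F \<omega> x .. upper_map F \<omega> x + 1}"
  shows "\<exists>y\<in>{x..x + 1}. F \<omega> y = z"
proof -
  obtain p where p: "p \<in> {x..x + 1}" "F \<omega> p = lower_map F \<omega> x"
    using lower_map_attained[of F \<omega> x, OF F] by metis
  obtain q where q: "q \<in> {x + 1 - 1..x + 1}" "F \<omega> q = upper_map F \<omega> (x + 1)"
    using upper_map_attained[of F \<omega> "x + 1", OF F] by metis
  have "upper_map F \<omega> (x + 1) = upper_map F \<omega> x + 1"
    using upper_map_mono_deg1[of F, OF F] by (simp add: mono_deg1_def)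
  then have pq: "F \<omega> p \<le> z" "z \<le> F \<omega> q" using p q z by auto
  \<comment> \<open>Connectedness of the image serves here because p may lie on either side of
    q.\<close>
  have "connected (F \<omega> ` {x..x + 1})"
    by (intro connected_continuous_image End1_real_continuous F) simp
  then have "{F \<omega> p..F \<omega> q} \<subseteq> F \<omega> ` {x..x + 1}"
    by (rule connected_contains_Icc) (use p(1) q(1) in \<open>intro imageI; simp\<close>)+
  then show ?thesis using pq by force
qed

section \<open>Shadowing of admissible sequences by true orbits\<close>

lemma cocycle_continuous:
  assumes "\<And>n. F ((\<sigma> ^^ n) \<omega>) \<in> End1_real"
  shows "continuous_on A (cocycle \<sigma> F n \<omega>)"
proof (induction n)
  case (Suc n)
  then show ?case
    unfolding cocycle.simps
    by (rule continuous_on_compose[OF _ End1_real_continuous[OF assms]])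
qed (simp add: continuous_on_id)

text \<open>A unit interval is mapped onto the interval from the lower map at its left end to the upper map
  at its right end, so every point of the last unit interval can be pulled back along the sequence.\<close>

lemma shadowing:
  assumes F: "\<And>n. F ((\<sigma> ^^ n) \<omega>) \<in> End1_real"
    and y: "\<And>n. y (Suc n) \<in> {lower_map F ((\<sigma> ^^ n) \<omega>) (y n) .. upper_map F ((\<sigma> ^^ n) \<omega>) (y n)}"
  shows "\<exists>x. \<forall>n. cocycle \<sigma> F n \<omega> x \<in> {y n..y n + 1}"
proof -
  \<comment> \<open>Starting points that obey the first n constraints; these sets are compact and
    nested, so one point obeys them all.\<close>
  define K where "K n = {x \<in> {y 0..y 0 + 1}. \<forall>k\<le>n. cocycle \<sigma> F k \<omega> x \<in> {y k..y k + 1}}" for n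
  \<comment> \<open>Mere nonemptiness of \<open>K n\<close> would not carry the induction: every
    point of the last unit interval must be reached.\<close>
  have reach: "\<exists>x\<in>K n. cocycle \<sigma> F n \<omega> x = z" if "z \<in> {y n..y n + 1}" for n z
    using that
  proof (induction n arbitrary: z)
    case (Suc n)
    have "z \<in> {lower_map F ((\<sigma> ^^ n) \<omega>) (y n) .. upper_map F ((\<sigma> ^^ n) \<omega>) (y n) + 1}"
      using Suc.prems y[of n] by auto
    then obtain z' where z': "z' \<in> {y n..y n + 1}" "F ((\<sigma> ^^ n) \<omega>) z' = z"
      using lower_upper_image[of F, OF F] by metis
    then obtain x where x: "x \<in> K n" "cocycle \<sigma> F n \<omega> x = z'"
      using Suc.IH by blast
    then have "cocycle \<sigma> F (Suc n) \<omega> x = z" using z' by simp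
    moreover from this have "x \<in> K (Suc n)"
      using x Suc.prems unfolding K_def by (auto simp: le_Suc_eq simp del: cocycle.simps(2))
    ultimately show ?case by blast
  qed (auto simp: K_def)
  have "compact (K n)" for n
  proof -
    have "K n = {y 0..y 0 + 1} \<inter> (\<Inter>k\<in>{..n}. cocycle \<sigma> F k \<omega> -` {y k..y k + 1})"
      by (auto simp: K_def)
    moreover have "closed (cocycle \<sigma> F k \<omega> -` {y k..y k + 1})" for k
      using continuous_closed_vimage[of "{y k..y k + 1}" "cocycle \<sigma> F k \<omega>"]
        cocycle_continuous[of F \<sigma> \<omega> UNIV k, OF F] by (simp add: continuous_on_eq_continuous_at)
    ultimately show ?thesis
      by (auto intro!: compact_Int_closed closed_INT)
  qed
  moreover have "K n \<noteq> {}" for n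
    using reach[of "y n" n] by auto
  moreover have "K n \<subseteq> K m" if "m \<le> n" for m n
    using that by (auto simp: K_def)
  ultimately have "\<Inter>(range K) \<noteq> {}"
    by (rule compact_nest)
  then obtain x where "\<And>n. x \<in> K n" by blast
  then show ?thesis unfolding K_def by blast
qed


section \<open>Targets with prescribed lower and upper slope\<close>

text \<open>With the double logarithm, n times the rate of change of the slope is of order 1 / ln n.
  A single logarithm would leave it of constant order, and increments of the target could leave the
  admissible range.\<close>

definition slope :: "real \<Rightarrow> real \<Rightarrow> nat \<Rightarrow> real" where
  "slope a b n = (a + b) / 2 + (b - a) / 2 * cos (pi * log 2 (log 2 (real n)))"

lemma slope_range:
  assumes "a \<le> b"
  shows "slope a b n \<in> {a..b}"
proof -
  let ?c = "cos (pi * log 2 (log 2 (real n)))"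
  have "(b - a) / 2 * ?c \<le> (b - a) / 2 * 1" "(b - a) / 2 * (-1) \<le> (b - a) / 2 * ?c"
    using assms by (intro mult_left_mono; simp)+
  then show ?thesis unfolding slope_def by (simp add: field_simps)
qed

lemma slope_power:
  "slope a b (2 ^ 2 ^ k) = (if even k then b else a)"
proof -
  have "log 2 (real (2 ^ 2 ^ k)) = 2 ^ k"
    by (simp only: of_nat_power of_nat_numeral) (subst log_pow_cancel, auto)
  then have "cos (pi * log 2 (log 2 (real (2 ^ 2 ^ k)))) = (- 1) ^ k"
    by simp
  then show ?thesis
    unfolding slope_def by (cases "even k") (auto simp: field_simps)
qed

text \<open>A null perturbation does not affect the upper limit. The range of \<open>slope\<close>
  bounds it by b, and the times with even k in \<open>slope_power\<close> attain b.\<close>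

lemma limsup_near_slope:
  assumes "a \<le> b" and v: "(\<lambda>n. v n - slope a b n) \<longlonglongrightarrow> 0"
  shows "limsup (\<lambda>n. ereal (v n)) = ereal b"
proof -
  let ?w = "\<lambda>n. ereal (slope a b n)"
  have "limsup (\<lambda>n. ereal (v n)) = limsup (\<lambda>n. ereal (v n - slope a b n) + ?w n)"
    by simp
  also have "\<dots> = 0 + limsup ?w"
    by (rule ereal_limsup_lim_add) (use v in \<open>auto simp: zero_ereal_def\<close>)
  also have "limsup ?w = ereal b"
  proof (rule antisym)
    show "limsup ?w \<le> ereal b"
      by (rule Limsup_bounded) (use slope_range[OF \<open>a \<le> b\<close>] in auto)
    have "strict_mono (\<lambda>k::nat. (2::nat) ^ 2 ^ (2 * k))"
      by (auto intro!: strict_monoI)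
    from limsup_subseq_mono[OF this, of ?w] show "ereal b \<le> limsup ?w"
      by (simp add: comp_def slope_power Limsup_const)
  qed
  finally show ?thesis by simp
qed

text \<open>The same with the times of odd k, where the slope is a.\<close>

lemma liminf_near_slope:
  assumes "a \<le> b" and v: "(\<lambda>n. v n - slope a b n) \<longlonglongrightarrow> 0"
  shows "liminf (\<lambda>n. ereal (v n)) = ereal a"
proof -
  let ?w = "\<lambda>n. ereal (slope a b n)"
  have "liminf (\<lambda>n. ereal (v n)) = liminf (\<lambda>n. ereal (v n - slope a b n) + ?w n)"
    by simp
  also have "\<dots> = 0 + liminf ?w"
    by (rule ereal_liminf_lim_add) (use v in \<open>auto simp: zero_ereal_def\<close>)
  also have "liminf ?w = ereal a"
  proof (rule antisym)
    show "ereal a \<le> liminf ?w"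
      by (rule Liminf_bounded) (use slope_range[OF \<open>a \<le> b\<close>] in auto)
    have "strict_mono (\<lambda>k::nat. (2::nat) ^ 2 ^ (2 * k + 1))"
      by (auto intro!: strict_monoI)
    from liminf_subseq_mono[OF this, of ?w] have "liminf ?w \<le> liminf (\<lambda>k::nat. ereal (slope a b (2 ^ 2 ^ (2 * k + 1))))"
      by (simp only: comp_def)
    then show "liminf ?w \<le> ereal a"
      unfolding slope_power by (simp add: Liminf_const)
  qed
  finally show ?thesis by simp
qed

section \<open>Slow variation of the slopes\<close>

lemma abs_cos_diff_le: "\<bar>cos x - cos y\<bar> \<le> \<bar>x - y\<bar>" for x y :: real
proof -
  have "\<bar>cos x - cos y\<bar> = 2 * (\<bar>sin ((x + y) / 2)\<bar> * \<bar>sin ((y - x) / 2)\<bar>)"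
    by (simp add: cos_diff_cos abs_mult)
  also have "\<dots> \<le> 2 * (1 * \<bar>(y - x) / 2\<bar>)"
    by (intro mult_left_mono mult_mono abs_sin_le_one abs_sin_x_le_abs_x) auto
  finally show ?thesis by simp
qed

text \<open>The inequality ln t \<le> t - 1 is used twice: for t = ln n / ln m and for t = n / m.
  The factor m then cancels.\<close>

lemma loglog_diff_bound:
  assumes "2 \<le> m" "m \<le> n"
  shows "real m * \<bar>log 2 (log 2 (real n)) - log 2 (log 2 (real m))\<bar> \<le> real n / (ln 2 * ln (real m))"
proof -
  have pos: "0 < ln (real m)" "ln (real m) \<le> ln (real n)" "0 < real m" "0 < ln (real n)"
    using assms by auto
  have eq: "log 2 (log 2 (real k)) = (ln (ln (real k)) - ln (ln 2)) / ln 2" if "0 < ln (real k)" for k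
    using that by (simp add: log_def ln_div)
  have "\<bar>log 2 (log 2 (real n)) - log 2 (log 2 (real m))\<bar> = (ln (ln (real n)) - ln (ln (real m))) / ln 2"
    using pos by (simp add: eq diff_divide_distrib[symmetric])
  also have "ln (ln (real n)) - ln (ln (real m)) = ln (ln (real n) / ln (real m))"
    using pos by (simp add: ln_div)
  also have "\<dots> \<le> ln (real n) / ln (real m) - 1"
    using pos by (intro ln_le_minus_one) simp
  also have "\<dots> = ln (real n / real m) / ln (real m)"
    using pos assms by (simp add: ln_div field_simps)
  also have "\<dots> \<le> (real n / real m) / ln (real m)"
  proof (rule divide_right_mono)
    show "ln (real n / real m) \<le> real n / real m"
      using ln_le_minus_one[of "real n / real m"] assms by simp
  qed (use pos in simp)
  finally have "\<bar>log 2 (log 2 (real n)) - log 2 (log 2 (real m))\<bar> \<le> real n / real m / ln (real m) / ln 2"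
    by (simp add: divide_right_mono)
  then have "real m * \<bar>log 2 (log 2 (real n)) - log 2 (log 2 (real m))\<bar> \<le>
      real m * (real n / real m / ln (real m) / ln 2)"
    by (rule mult_left_mono) simp
  then show ?thesis using pos by (simp add: mult.commute)
qed

text \<open>For large m the factor 1 / ln m is small. For the finitely many other m the slopes
  differ by at most b - a, which is absorbed by a large n.\<close>

lemma slope_slow_variation:
  assumes "a \<le> b" "\<epsilon> > 0"
  shows "eventually (\<lambda>n. \<forall>m\<le>n. real m * \<bar>slope a b n - slope a b m\<bar> \<le> \<epsilon> * real n) sequentially"
proof -
  let ?p = "\<lambda>n. log 2 (log 2 (real n))"
  \<comment> \<open>Amplitude of the cosine, its frequency, and the \<open>ln 2\<close> of
    \<open>loglog_diff_bound\<close>.\<close>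
  define c where "c = (b - a) / 2 * pi / ln 2"
  have c: "0 \<le> c" using assms by (simp add: c_def)
  have "filterlim (\<lambda>m. ln (real m)) at_top sequentially"
    by (rule filterlim_compose[OF ln_at_top filterlim_real_sequentially])
  then have "eventually (\<lambda>m. c / \<epsilon> \<le> ln (real m)) sequentially"
    by (simp add: filterlim_at_top)
  then obtain N where N: "\<And>m. m \<ge> N \<Longrightarrow> c / \<epsilon> \<le> ln (real m)"
    by (auto simp: eventually_sequentially)
  obtain K :: nat where K: "real (N + 2) * (b - a) / \<epsilon> \<le> real K" using real_arch_simple by blast
  have "real m * \<bar>slope a b n - slope a b m\<bar> \<le> \<epsilon> * real n" if "n \<ge> K" "m \<le> n" for m n
  proof (cases "m \<le> N + 2")
    case True
    have "\<bar>slope a b n - slope a b m\<bar> \<le> b - a"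
      using slope_range[OF \<open>a \<le> b\<close>, of n] slope_range[OF \<open>a \<le> b\<close>, of m] by auto
    then have "real m * \<bar>slope a b n - slope a b m\<bar> \<le> real (N + 2) * (b - a)"
      using True by (intro mult_mono) auto
    also have "\<dots> \<le> \<epsilon> * real K" using K \<open>\<epsilon> > 0\<close> by (simp add: field_simps)
    also have "\<dots> \<le> \<epsilon> * real n" using that \<open>\<epsilon> > 0\<close> by simp
    finally show ?thesis .
  next
    case False
    then have m: "2 \<le> m" "N \<le> m" by auto
    have ln: "0 < ln (real m)" using m by simp
    have "\<bar>slope a b n - slope a b m\<bar> = (b - a) / 2 * \<bar>cos (pi * ?p n) - cos (pi * ?p m)\<bar>"
    proof -
      have "slope a b n - slope a b m = (b - a) / 2 * (cos (pi * ?p n) - cos (pi * ?p m))"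
        unfolding slope_def right_diff_distrib by simp
      then show ?thesis using \<open>a \<le> b\<close> by (simp only: abs_mult) simp
    qed
    also have "\<dots> \<le> (b - a) / 2 * \<bar>pi * ?p n - pi * ?p m\<bar>"
      using \<open>a \<le> b\<close> by (intro mult_left_mono abs_cos_diff_le) simp
    also have "\<dots> = (b - a) / 2 * pi * \<bar>?p n - ?p m\<bar>"
      by (simp add: right_diff_distrib[symmetric] abs_mult)
    finally have "real m * \<bar>slope a b n - slope a b m\<bar> \<le> real m * ((b - a) / 2 * pi * \<bar>?p n - ?p m\<bar>)"
      by (rule mult_left_mono) simp
    also have "\<dots> = (b - a) / 2 * pi * (real m * \<bar>?p n - ?p m\<bar>)"
      by (simp add: mult_ac)
    also have "\<dots> \<le> (b - a) / 2 * pi * (real n / (ln 2 * ln (real m)))"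
      using \<open>a \<le> b\<close> by (intro mult_left_mono loglog_diff_bound m that) simp
    also have "\<dots> = c / ln (real m) * real n"
      by (simp add: c_def)
    also have "\<dots> \<le> \<epsilon> * real n"
    proof (rule mult_right_mono)
      show "c / ln (real m) \<le> \<epsilon>"
        using N[OF m(2)] ln \<open>\<epsilon> > 0\<close> by (simp add: field_simps)
    qed simp
    finally show ?thesis .
  qed
  then show ?thesis
    by (intro eventually_sequentiallyI[of K]) blast
qed

lemma slope_target:
  assumes "l \<le> a" "a \<le> b" "b \<le> u" "\<epsilon> > 0"
  defines "T \<equiv> \<lambda>n. real n * slope a b n"
  shows "eventually (\<lambda>n. \<forall>m\<le>n.
      T n - T m \<in> {l * (real n - real m) - \<epsilon> * real n .. u * (real n - real m) + \<epsilon> * real n}) sequentially"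
  using slope_slow_variation[OF assms(2,4)]
proof eventually_elim
  case (elim n)
  show ?case
  proof (intro allI impI)
    fix m assume m: "m \<le> n"
    let ?w = "slope a b"
    \<comment> \<open>A discrete product rule: the first term has slope in [a, b], the second is the
      slow variation.\<close>
    have "T n - T m = ?w n * (real n - real m) + real m * (?w n - ?w m)"
      by (simp add: T_def algebra_simps)
    moreover have "\<bar>real m * (?w n - ?w m)\<bar> \<le> \<epsilon> * real n"
      using elim m by (simp add: abs_mult)
    moreover have "l * (real n - real m) \<le> ?w n * (real n - real m)"
        "?w n * (real n - real m) \<le> u * (real n - real m)"
      using slope_range[OF assms(2), of n] assms m by (auto intro!: mult_right_mono)
    ultimately show "T n - T m \<in> {l * (real n - real m) - \<epsilon> * real n .. u * (real n - real m) + \<epsilon> * real n}"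
      by auto
  qed
qed


section \<open>Measurability and rotation numbers\<close>

lemma space_sup_borel: "space (sup_borel A) = A"
  unfolding sup_borel_def by (rule space_measure_of) auto

text \<open>The set where g x exceeds c is open: around f it contains the ball of radius f x -
  c.\<close>

lemma eval_measurable_sup_borel: "(\<lambda>g. g x) \<in> borel_measurable (sup_borel End1_real)"
proof (rule borel_measurableI_greater)
  fix c :: real
  let ?U = "{g \<in> End1_real. c < g x}"
  have "\<exists>e>0. \<forall>g\<in>End1_real. sup_dist f g < e \<longrightarrow> g \<in> ?U" if f: "f \<in> ?U" for f
  proof (intro exI[of _ "f x - c"] conjI ballI impI)
    fix g assume g: "g \<in> End1_real" and "sup_dist f g < f x - c"
    moreover have "dist (f x) (g x) \<le> sup_dist f g"
      unfolding sup_dist_def using f g by (intro cSUP_upper End1_real_bdd) auto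
    ultimately show "g \<in> ?U" by (auto simp: dist_real_def)
  qed (use f in auto)
  then show "{g \<in> space (sup_borel End1_real). c < g x} \<in> sets (sup_borel End1_real)"
    unfolding space_sup_borel unfolding sup_borel_def by (intro in_measure_of) auto
qed

lemma sup_dist_id_bound:
  assumes "f \<in> End1_real"
  shows "\<bar>f x - x\<bar> \<le> sup_dist f id"
proof -
  have "id \<in> End1_real" by (simp add: End1_real_def continuous_on_id)
  then have "dist (f x) (id x) \<le> sup_dist f id"
    unfolding sup_dist_def by (intro cSUP_upper End1_real_bdd[OF assms] UNIV_I)
  then show ?thesis by (simp add: dist_real_def)
qed

text \<open>The Caratheodory argument: round \<open>g\<close> down to multiples of 1 / (k + 1),
  which leaves countably many evaluation points, and pass to the limit by continuity.\<close>

lemma measurable_eval_continuous: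
  fixes F :: "'w \<Rightarrow> real \<Rightarrow> real"
  assumes cont: "\<And>\<omega>. \<omega> \<in> space M \<Longrightarrow> continuous_on UNIV (F \<omega>)"
    and meas: "\<And>x. (\<lambda>\<omega>. F \<omega> x) \<in> borel_measurable M"
    and g [measurable]: "g \<in> borel_measurable M"
  shows "(\<lambda>\<omega>. F \<omega> (g \<omega>)) \<in> borel_measurable M"
proof (rule borel_measurable_LIMSEQ_real)
  let ?a = "\<lambda>k \<omega>. \<lfloor>real (Suc k) * g \<omega>\<rfloor>"
  show "(\<lambda>\<omega>. F \<omega> (of_int (?a k \<omega>) / real (Suc k))) \<in> borel_measurable M" for k
    by (rule measurable_compose_countable[where f = "\<lambda>i \<omega>. F \<omega> (of_int i / real (Suc k))"]) (rule meas, measurable)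
  fix \<omega> assume \<omega>: "\<omega> \<in> space M"
  have "(\<lambda>k. of_int (?a k \<omega>) / real (Suc k)) \<longlonglongrightarrow> g \<omega>"
  proof (rule tendsto_sandwich)
    show "(\<lambda>k. g \<omega> - 1 / real (Suc k)) \<longlonglongrightarrow> g \<omega>"
      using tendsto_diff[OF tendsto_const LIMSEQ_Suc[OF lim_const_over_n[of "1::real"]], of "g \<omega>"] by simp
    show "eventually (\<lambda>k. g \<omega> - 1 / real (Suc k) \<le> of_int (?a k \<omega>) / real (Suc k)) sequentially"
    proof (rule always_eventually, rule allI)
      fix k
      have "real (Suc k) * g \<omega> - 1 \<le> of_int (?a k \<omega>)" by linarith
      then have "(real (Suc k) * g \<omega> - 1) / real (Suc k) \<le> of_int (?a k \<omega>) / real (Suc k)"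
        by (rule divide_right_mono) simp
      then show "g \<omega> - 1 / real (Suc k) \<le> of_int (?a k \<omega>) / real (Suc k)"
        by (simp add: diff_divide_distrib del: of_nat_Suc)
    qed
    show "eventually (\<lambda>k. of_int (?a k \<omega>) / real (Suc k) \<le> g \<omega>) sequentially"
    proof (rule always_eventually, rule allI)
      fix k
      have "of_int (?a k \<omega>) / real (Suc k) \<le> (real (Suc k) * g \<omega>) / real (Suc k)"
        by (rule divide_right_mono) simp_all
      then show "of_int (?a k \<omega>) / real (Suc k) \<le> g \<omega>" by (simp del: of_nat_Suc)
    qed
  qed simp
  then show "(\<lambda>k. F \<omega> (of_int (?a k \<omega>) / real (Suc k))) \<longlonglongrightarrow> F \<omega> (g \<omega>)"
    by (rule continuous_on_tendsto_compose[OF cont[OF \<omega>]]) auto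
qed

text \<open>By continuity rational offsets suffice. The countable index set does not depend on x, so
  x may itself be random.\<close>

lemma lower_map_eq_rat:
  assumes F: "F \<omega> \<in> End1_real"
  shows "lower_map F \<omega> x = (INF q\<in>{q \<in> \<rat>. 0 \<le> q}. F \<omega> (x + q))"
proof -
  let ?Q = "{q \<in> \<rat>. 0 \<le> (q::real)}"
  obtain p where p: "p \<in> {x..x + 1}" "F \<omega> p = lower_map F \<omega> x" "\<And>q. x \<le> q \<Longrightarrow> F \<omega> p \<le> F \<omega> q"
    using lower_map_attained[of F \<omega> x, OF F] by metis
  have bdd: "bdd_below ((\<lambda>q. F \<omega> (x + q)) ` ?Q)"
    using p(3) by (intro bdd_belowI2[of _ "F \<omega> p"]) auto
  have "F \<omega> p \<le> (INF q\<in>?Q. F \<omega> (x + q))"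
    using p(3) by (intro cINF_greatest) (auto intro: exI[of _ "0::real"])
  moreover have "(INF q\<in>?Q. F \<omega> (x + q)) \<le> F \<omega> p"
  proof (rule field_le_epsilon)
    fix e :: real assume "e > 0"
    have "isCont (F \<omega>) p"
      using End1_real_continuous[OF F, of UNIV] by (simp add: continuous_on_eq_continuous_at)
    then obtain d where d: "d > 0" "\<And>y. dist y p < d \<Longrightarrow> dist (F \<omega> y) (F \<omega> p) < e"
      using \<open>e > 0\<close> unfolding continuous_at_eps_delta by (metis dist_real_def)
    obtain q where q: "q \<in> \<rat>" "p - x < q" "q < p - x + d"
      using Rats_dense_in_real[of "p - x" "p - x + d"] d by auto
    then have "q \<in> ?Q" using p(1) by auto
    then have "(INF q\<in>?Q. F \<omega> (x + q)) \<le> F \<omega> (x + q)"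
      by (rule cINF_lower[OF bdd])
    also have "\<dots> \<le> F \<omega> p + e"
      using d(2)[of "x + q"] q by (auto simp: dist_real_def)
    finally show "(INF q\<in>?Q. F \<omega> (x + q)) \<le> F \<omega> p + e" .
  qed
  ultimately show ?thesis using p(2) by simp
qed

lemma measurable_lower_map:
  fixes F :: "'w \<Rightarrow> real \<Rightarrow> real"
  assumes End: "\<And>\<omega>. \<omega> \<in> space M \<Longrightarrow> F \<omega> \<in> End1_real"
    and meas: "\<And>x. (\<lambda>\<omega>. F \<omega> x) \<in> borel_measurable M"
    and g: "g \<in> borel_measurable M"
  shows "(\<lambda>\<omega>. lower_map F \<omega> (g \<omega>)) \<in> borel_measurable M"
proof -
  have "(\<lambda>\<omega>. INF q\<in>{q \<in> \<rat>. 0 \<le> q}. F \<omega> (g \<omega> + q)) \<in> borel_measurable M"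
  proof (rule borel_measurable_cINF_real)
    show "countable {q \<in> \<rat>. 0 \<le> (q::real)}"
      by (rule countable_subset[OF _ countable_rat]) auto
    show "(\<lambda>\<omega>. F \<omega> (g \<omega> + q)) \<in> borel_measurable M" for q
      by (rule measurable_eval_continuous[OF End1_real_continuous[OF End] meas borel_measurable_add[OF g]]) simp_all
  qed
  then show ?thesis
    by (rule measurable_cong[THEN iffD1, rotated]) (rule lower_map_eq_rat[of F, OF End, symmetric])
qed

section \<open>Cocycles of monotone maps\<close>

lemma cocycle_add:
  "cocycle \<sigma> G (m + n) \<omega> x = cocycle \<sigma> G n ((\<sigma> ^^ m) \<omega>) (cocycle \<sigma> G m \<omega> x)"
proof (induction n)
  case (Suc n)
  have "(\<sigma> ^^ n) ((\<sigma> ^^ m) \<omega>) = (\<sigma> ^^ (m + n)) \<omega>"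
    by (simp add: add.commute[of m] funpow_add)
  then show ?case using Suc by simp
qed simp

lemma cocycle_mono_deg1:
  assumes "\<And>n. mono_deg1 (G ((\<sigma> ^^ n) \<omega>))"
  shows "mono_deg1 (cocycle \<sigma> G n \<omega>)"
proof (induction n)
  case (Suc n)
  show ?case unfolding cocycle.simps by (rule mono_deg1_comp[OF assms Suc])
qed (simp only: cocycle.simps mono_deg1_id)

lemma orbit_eq_cocycle: "orbit (\<lambda>n. G ((\<sigma> ^^ n) \<omega>)) n = cocycle \<sigma> G n \<omega> 0"
  by (induction n) auto

text \<open>A general bound \<open>s\<close> in place of \<open>sup_dist (F \<omega>) id\<close>
  lets \<open>reflect F\<close> be an instance with the same \<open>s\<close>.\<close>

locale integrable_lift = ergodic_system M \<sigma> for M :: "'w measure" and \<sigma> +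
  fixes F :: "'w \<Rightarrow> real \<Rightarrow> real" and s :: "'w \<Rightarrow> real"
  assumes End1: "\<omega> \<in> space M \<Longrightarrow> F \<omega> \<in> End1_real"
    and eval_measurable: "(\<lambda>\<omega>. F \<omega> x) \<in> borel_measurable M"
    and integrable_bound_fun: "integrable M s"
    and displacement_bound: "\<omega> \<in> space M \<Longrightarrow> \<bar>F \<omega> x - x\<bar> \<le> s \<omega>"
begin

lemma End1_shift: "\<omega> \<in> space M \<Longrightarrow> F ((\<sigma> ^^ n) \<omega>) \<in> End1_real"
  by (intro End1 shift_power_space)

lemma lower_cocycle_measurable: "(\<lambda>\<omega>. cocycle \<sigma> (lower_map F) n \<omega> 0) \<in> borel_measurable M"
proof (induction n)
  case (Suc n)
  \<comment> \<open>The shift is absorbed into the random map, so that the inner cocycle value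
    becomes the random evaluation point.\<close>
  have "(\<lambda>\<omega>. lower_map (\<lambda>\<omega>. F ((\<sigma> ^^ n) \<omega>)) \<omega> (cocycle \<sigma> (lower_map F) n \<omega> 0)) \<in> borel_measurable M"
    by (rule measurable_lower_map[OF End1_shift measurable_compose[OF shift_power_measurable eval_measurable] Suc])
  moreover have "lower_map (\<lambda>\<omega>. F ((\<sigma> ^^ n) \<omega>)) \<omega> = lower_map F ((\<sigma> ^^ n) \<omega>)" for \<omega>
    by (simp add: lower_map_def fun_eq_iff)
  ultimately show ?case by simp
qed simp

lemma lower_cocycle_mono_deg1: "\<omega> \<in> space M \<Longrightarrow> mono_deg1 (cocycle \<sigma> (lower_map F) n \<omega>)"
  by (intro cocycle_mono_deg1 lower_map_mono_deg1 End1_shift)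

lemma lower_map_bound:
  assumes \<omega>: "\<omega> \<in> space M"
  shows "\<bar>lower_map F \<omega> 0\<bar> \<le> s \<omega>"
proof -
  obtain p where p: "p \<in> {0..0 + 1}" "F \<omega> p = lower_map F \<omega> 0" "\<And>q. 0 \<le> q \<Longrightarrow> F \<omega> p \<le> F \<omega> q"
    using lower_map_attained[of F \<omega> 0, OF End1[OF \<omega>]] by metis
  show ?thesis
    using p(1,2) p(3)[of 0] displacement_bound[OF \<omega>, of p] displacement_bound[OF \<omega>, of 0] by auto
qed

lemma lower_cocycle_almost_additive:
  assumes \<omega>: "\<omega> \<in> space M"
  shows "\<bar>cocycle \<sigma> (lower_map F) (m + n) \<omega> 0 - cocycle \<sigma> (lower_map F) m \<omega> 0 -
    cocycle \<sigma> (lower_map F) n ((\<sigma> ^^ m) \<omega>) 0\<bar> \<le> 1"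
  using mono_deg1_diff[OF lower_cocycle_mono_deg1[OF shift_power_space[OF \<omega>, of m], of n],
      of "cocycle \<sigma> (lower_map F) m \<omega> 0" 0]
  unfolding cocycle_add by linarith

text \<open>One more step adds at most the bound \<open>s\<close> of the new map and the defect 1 of
  almost additivity.\<close>

lemma lower_cocycle_integrable: "integrable M (\<lambda>\<omega>. cocycle \<sigma> (lower_map F) n \<omega> 0)"
proof (induction n)
  case (Suc n)
  let ?\<phi> = "\<lambda>n \<omega>. cocycle \<sigma> (lower_map F) n \<omega> 0"
  have "integrable M (\<lambda>\<omega>. \<bar>?\<phi> n \<omega>\<bar> + s ((\<sigma> ^^ n) \<omega>) + 1)"
    using Suc integrable_shift_power[OF integrable_bound_fun] by auto
  then show ?case
  proof (rule Bochner_Integration.integrable_bound)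
    show "?\<phi> (Suc n) \<in> borel_measurable M" by (rule lower_cocycle_measurable)
    show "AE \<omega> in M. norm (?\<phi> (Suc n) \<omega>) \<le> norm (\<bar>?\<phi> n \<omega>\<bar> + s ((\<sigma> ^^ n) \<omega>) + 1)"
    proof (rule AE_I2)
      fix \<omega> assume \<omega>: "\<omega> \<in> space M"
      have "\<bar>?\<phi> (Suc n) \<omega> - ?\<phi> n \<omega> - lower_map F ((\<sigma> ^^ n) \<omega>) 0\<bar> \<le> 1"
        using lower_cocycle_almost_additive[OF \<omega>, of n 1] by simp
      then show "norm (?\<phi> (Suc n) \<omega>) \<le> norm (\<bar>?\<phi> n \<omega>\<bar> + s ((\<sigma> ^^ n) \<omega>) + 1)"
        using lower_map_bound[OF shift_power_space[OF \<omega>, of n]] by (simp del: cocycle.simps)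
    qed
  qed
qed simp

text \<open>The limit at 0 comes from almost additivity; displacements from any other x differ from
  it by at most 1.\<close>

lemma lower_rotation_number:
  obtains c where "is_random_rotation_number M \<sigma> (lower_map F) (\<lambda>_. c)"
proof -
  let ?\<phi> = "\<lambda>n \<omega>. cocycle \<sigma> (lower_map F) n \<omega> 0"
  obtain c where c: "AE \<omega> in M. (\<lambda>n. ?\<phi> n \<omega> / real n) \<longlonglongrightarrow> c"
    using almost_additive_ergodic[of ?\<phi> 1, OF lower_cocycle_integrable lower_cocycle_almost_additive] .
  have "AE \<omega> in M. (\<lambda>n. (cocycle \<sigma> (lower_map F) n \<omega> x - x) / real n) \<longlonglongrightarrow> c" for x
    using c AE_space
  proof eventually_elim
    case (elim \<omega>)
    have "(\<lambda>n. (cocycle \<sigma> (lower_map F) n \<omega> x - x) / real n - ?\<phi> n \<omega> / real n) \<longlonglongrightarrow> 0"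
    proof (rule tendsto_rabs_zero_cancel, rule tendsto_sandwich[OF _ _ tendsto_const lim_const_over_n[of 1]])
      show "eventually (\<lambda>n. \<bar>(cocycle \<sigma> (lower_map F) n \<omega> x - x) / real n - ?\<phi> n \<omega> / real n\<bar> \<le> 1 / real n) sequentially"
      proof (rule always_eventually, rule allI)
        fix n
        have "\<bar>cocycle \<sigma> (lower_map F) n \<omega> x - x - ?\<phi> n \<omega>\<bar> \<le> 1"
          using mono_deg1_diff[OF lower_cocycle_mono_deg1[OF elim(2), of n], of x 0] by linarith
        then show "\<bar>(cocycle \<sigma> (lower_map F) n \<omega> x - x) / real n - ?\<phi> n \<omega> / real n\<bar> \<le> 1 / real n"
          by (simp add: diff_divide_distrib[symmetric] abs_divide divide_right_mono)
      qed
    qed simp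
    from tendsto_add[OF this elim(1)] show ?case by simp
  qed
  then show thesis
    by (intro that[of c]) (auto simp: is_random_rotation_number_def)
qed

lemma reflect_integrable_lift: "integrable_lift M \<sigma> (reflect F) s"
proof unfold_locales
  fix \<omega> x assume \<omega>: "\<omega> \<in> space M"
  show "reflect F \<omega> \<in> End1_real" by (rule reflect_End1[of F, OF End1[OF \<omega>]])
  show "\<bar>reflect F \<omega> x - x\<bar> \<le> s \<omega>"
    using displacement_bound[OF \<omega>, of "- x"] by (simp add: reflect_def)
next
  show "(\<lambda>\<omega>. reflect F \<omega> x) \<in> borel_measurable M" for x
    unfolding reflect_def using eval_measurable by (intro borel_measurable_uminus)
qed (rule integrable_bound_fun)

lemma upper_cocycle_eq:
  assumes "\<omega> \<in> space M"
  shows "cocycle \<sigma> (upper_map F) n \<omega> x = - cocycle \<sigma> (lower_map (reflect F)) n \<omega> (- x)"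
  by (induction n) (simp_all add: upper_map_eq_reflect[of F, OF End1_shift[OF assms]])

text \<open>It is minus the lower rotation number of \<open>reflect F\<close>.\<close>

lemma upper_rotation_number:
  obtains c where "is_random_rotation_number M \<sigma> (upper_map F) (\<lambda>_. c)"
proof -
  obtain c where c: "is_random_rotation_number M \<sigma> (lower_map (reflect F)) (\<lambda>_. c)"
    using integrable_lift.lower_rotation_number[OF reflect_integrable_lift] .
  have "AE \<omega> in M. (\<lambda>n. (cocycle \<sigma> (upper_map F) n \<omega> x - x) / real n) \<longlonglongrightarrow> - c" for x
  proof -
    have "AE \<omega> in M. (\<lambda>n. (cocycle \<sigma> (lower_map (reflect F)) n \<omega> (- x) - (- x)) / real n) \<longlonglongrightarrow> c"
      using c unfolding is_random_rotation_number_def by blast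
    then show ?thesis
      using AE_space
    proof eventually_elim
      case (elim \<omega>)
      have eq: "(cocycle \<sigma> (upper_map F) n \<omega> x - x) / real n =
          - ((cocycle \<sigma> (lower_map (reflect F)) n \<omega> (- x) - (- x)) / real n)" for n
        unfolding upper_cocycle_eq[OF elim(2)] by (simp add: minus_divide_left)
      show ?case unfolding eq by (rule tendsto_minus[OF elim(1)])
    qed
  qed
  then show thesis
    by (intro that[of "- c"]) (auto simp: is_random_rotation_number_def)
qed

lemma prescribed_rotation_set:
  assumes \<omega>: "\<omega> \<in> space M"
    and l: "(\<lambda>n. cocycle \<sigma> (lower_map F) n \<omega> 0 / real n) \<longlonglongrightarrow> l"
    and u: "(\<lambda>n. cocycle \<sigma> (upper_map F) n \<omega> 0 / real n) \<longlonglongrightarrow> u"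
    and ab: "l \<le> a" "a \<le> b" "b \<le> u"
  shows "\<exists>x. liminf (\<lambda>n. ereal ((cocycle \<sigma> F n \<omega> x - x) / real n)) = ereal a \<and>
    limsup (\<lambda>n. ereal ((cocycle \<sigma> F n \<omega> x - x) / real n)) = ereal b"
proof -
  define G where "G n = lower_map F ((\<sigma> ^^ n) \<omega>)" for n
  define H where "H n = upper_map F ((\<sigma> ^^ n) \<omega>)" for n
  define T where "T n = real n * slope a b n" for n
  define y where "y = tracking G H T"
  note E = End1_shift[OF \<omega>]
  have G: "mono_deg1 (G n)" and H: "mono_deg1 (H n)" and GH: "G n x \<le> H n x" for n x
    unfolding G_def H_def by (intro lower_map_mono_deg1 upper_map_mono_deg1 lower_le_upper_map E)+
  have "(\<lambda>n. orbit G n / real n) \<longlonglongrightarrow> l" "(\<lambda>n. orbit H n / real n) \<longlonglongrightarrow> u"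
    using l u unfolding G_def[abs_def] H_def[abs_def] orbit_eq_cocycle by auto
  then have yT: "(\<lambda>n. (y n - T n) / real n) \<longlonglongrightarrow> 0"
    unfolding y_def
    by (rule tracking_asymptotic[OF G H GH]) (unfold T_def, rule slope_target[OF ab])
  have "y (Suc n) \<in> {lower_map F ((\<sigma> ^^ n) \<omega>) (y n) .. upper_map F ((\<sigma> ^^ n) \<omega>) (y n)}" for n
    using tracking_between[of G H T n, OF GH] unfolding y_def G_def H_def .
  from shadowing[of F \<sigma> \<omega> y, OF E this]
  obtain x where x: "\<And>n. cocycle \<sigma> F n \<omega> x \<in> {y n..y n + 1}" by blast
  let ?v = "\<lambda>n. (cocycle \<sigma> F n \<omega> x - x) / real n"
  have close: "(\<lambda>n. (cocycle \<sigma> F n \<omega> x - y n) / real n) \<longlonglongrightarrow> 0"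
  proof (rule tendsto_sandwich[OF _ _ tendsto_const lim_const_over_n[of 1]])
    show "eventually (\<lambda>n. 0 \<le> (cocycle \<sigma> F n \<omega> x - y n) / real n) sequentially"
      using x by (intro always_eventually allI) auto
    have "cocycle \<sigma> F n \<omega> x - y n \<le> 1" for n
      using x[of n] by auto
    then show "eventually (\<lambda>n. (cocycle \<sigma> F n \<omega> x - y n) / real n \<le> 1 / real n) sequentially"
      by (intro always_eventually allI divide_right_mono) auto
  qed
  \<comment> \<open>The displacement splits into shadowing error, tracking error, target and -x; the
    target divided by n is the slope.\<close>
  have "(\<lambda>n. (cocycle \<sigma> F n \<omega> x - y n) / real n + (y n - T n) / real n - x / real n) \<longlonglongrightarrow> 0 + 0 - 0"
    by (intro tendsto_intros close yT lim_const_over_n)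
  then have "(\<lambda>n. ?v n - slope a b n) \<longlonglongrightarrow> 0 + 0 - 0"
  proof (rule Lim_transform_eventually)
    show "eventually (\<lambda>n. (cocycle \<sigma> F n \<omega> x - y n) / real n + (y n - T n) / real n - x / real n =
        ?v n - slope a b n) sequentially"
      using eventually_gt_at_top[of 0]
      by eventually_elim (simp add: T_def field_simps)
  qed
  then have "(\<lambda>n. ?v n - slope a b n) \<longlonglongrightarrow> 0" by simp
  from liminf_near_slope[OF ab(2) this] limsup_near_slope[OF ab(2) this] show ?thesis by blast
qed

end

theorem theorem2p2:
  fixes M :: "'w measure" and \<sigma> :: "'w \<Rightarrow> 'w"
    and f :: "'w \<Rightarrow> circle \<Rightarrow> circle" and F :: "'w \<Rightarrow> real \<Rightarrow> real" and a b :: real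
  assumes "ergodic_system M \<sigma>"
    and "random_circle_endomorphism M f"
    and "random_lift M f F"
    and "F \<in> integrable_End1 M"
    and "a \<in> {mean_rotation_number M \<sigma> (lower_map F) .. mean_rotation_number M \<sigma> (upper_map F)}"
    and "b \<in> {mean_rotation_number M \<sigma> (lower_map F) .. mean_rotation_number M \<sigma> (upper_map F)}"
    and "a \<le> b"
  shows "\<exists>\<Omega>' \<in> sets M. measure M \<Omega>' = 1 \<and>
           (\<forall>\<omega>\<in>\<Omega>'. \<exists>x :: real.
              liminf (\<lambda>n. ereal ((cocycle \<sigma> F n \<omega> x - x) / real n)) = ereal a \<and>
              limsup (\<lambda>n. ereal ((cocycle \<sigma> F n \<omega> x - x) / real n)) = ereal b)"
proof -
  interpret ergodic_system M \<sigma> by fact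
  have F: "F \<in> measurable M (sup_borel End1_real)" and int: "integrable M (\<lambda>\<omega>. sup_dist (F \<omega>) id)"
    using assms(4) by (auto simp: integrable_End1_def)
  have End: "F \<omega> \<in> End1_real" if "\<omega> \<in> space M" for \<omega>
    using measurable_space[OF F that] by (simp add: space_sup_borel)
  interpret integrable_lift M \<sigma> F "\<lambda>\<omega>. sup_dist (F \<omega>) id"
    by unfold_locales
      (auto intro: End int sup_dist_id_bound measurable_compose[OF F eval_measurable_sup_borel])
  obtain l where l: "is_random_rotation_number M \<sigma> (lower_map F) (\<lambda>_. l)"
    by (rule lower_rotation_number)
  obtain u where u: "is_random_rotation_number M \<sigma> (upper_map F) (\<lambda>_. u)"
    by (rule upper_rotation_number)
  \<comment> \<open>The rotation numbers are constants on a space of mass 1, hence equal to their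
    means.\<close>
  have "l \<le> a" "b \<le> u"
    using assms(5,6) mean_rotation_number_eq[OF l] mean_rotation_number_eq[OF u]
    by (auto simp: prob_space)
  have "AE \<omega> in M. (\<lambda>n. (cocycle \<sigma> (lower_map F) n \<omega> 0 - 0) / real n) \<longlonglongrightarrow> l"
      "AE \<omega> in M. (\<lambda>n. (cocycle \<sigma> (upper_map F) n \<omega> 0 - 0) / real n) \<longlonglongrightarrow> u"
    using l u unfolding is_random_rotation_number_def by blast+
  then have "AE \<omega> in M. \<exists>x. liminf (\<lambda>n. ereal ((cocycle \<sigma> F n \<omega> x - x) / real n)) = ereal a \<and>
      limsup (\<lambda>n. ereal ((cocycle \<sigma> F n \<omega> x - x) / real n)) = ereal b" (is "AE \<omega> in M. ?P \<omega>")
    using AE_space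
  proof eventually_elim
    case (elim \<omega>)
    then show ?case
      by (intro prescribed_rotation_set[OF _ _ _ \<open>l \<le> a\<close> \<open>a \<le> b\<close> \<open>b \<le> u\<close>]) simp_all
  qed
  \<comment> \<open>The complement of a measurable null set containing all exceptions serves as the
    full-measure set, so no measurability of \<open>?P\<close> enters.\<close>
  then obtain N where N: "\<And>\<omega>. \<omega> \<in> space M - N \<Longrightarrow> ?P \<omega>" "N \<in> null_sets M"
    by (rule AE_E3) auto
  show ?thesis
  proof (intro bexI[of _ "space M - N"] conjI ballI)
    show "prob (space M - N) = 1"
      using N(2) prob_compl[of N] by (auto simp: measure_eq_0_null_sets)
    show "?P \<omega>" if "\<omega> \<in> space M - N" for \<omega>
      by (rule N(1)[OF that])
    show "space M - N \<in> sets M" using N(2) by auto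
  qed
qed

end
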